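(* Let $G$ be a finitely generated monoid and let $F_2$ be the free group of rank $2$. (1) $\mathbf{AGWP}(G)$ is $\mathbf{P}$-time reducible to $\mathbf{SSP}(G*F_2)$, where $G*F_2$ is the free product. (2) $\mathbf{AGWP}(G)$ is $\mathbf{P}$-time reducible to $\mathbf{SSP}(G\times F_2)$.
   Context: Let $K$ be a monoid generated by a finite set $X$; elements of $K$ are given as words over $X$ (over $X\cup X^{-1}$ if $K$ is a group). Complexity does not depend on the choice of finite $X$. $\mathbf{SSP}(K)$ (subset sum problem): given $g_1,\dots,g_k,g\in K$, decide whether $g=g_1^{\varepsilon_1}\cdots g_k^{\varepsilon_k}$ for some $\varepsilon_1,\dots,\varepsilon_k\in\{0,1\}$. $\mathbf{AGWP}(K)$ (acyclic graph word problem): given a finite acyclic directed graph $\Gamma$ with edges labeled by letters in $X\cup\{\varepsilon\}$ ($\varepsilon$ the empty word), two marked vertices $\alpha,\omega$, and a word $w_0$ in $X$, decide whether there is an oriented path in $\Gamma$ from $\alpha$ to $\omega$ labeled by a word $w$ with $w=w_0$ in $K$. (If $K$ is a group, this is linear-time equivalent to the version with labels in $X\cup X^{-1}\cup\{\varepsilon\}$ and $w_0=1$.) A decision problem $(I_1,D_1)$ (instances, positive instances) is $\mathbf{P}$-time reducible to $(I_2,D_2)$ if there is a polynomial-time computable $f:I_1\to I_2$ with $u\in D_1\iff f(u)\in D_2$ for all $u\in I_1$. *)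

theory Defs
  imports "HOL-Algebra.Group" "HOL-Computational_Algebra.Polynomial"
begin

section \<open>Polynomial-time computability\<close>

text \<open>
  Deterministic Turing machines with finitely many two-way infinite tapes. A tape is given
  relative to its head: cell \<open>0\<close> is the scanned one, and moving the head re-indexes the tape.
  Symbol \<open>0\<close> is the blank. The working states are \<open>{..<tm_states M}\<close>, the initial state is \<open>0\<close>
  and the halting state is \<open>tm_states M\<close>. Input and output are on the first tape.
\<close>

datatype move = Move_Left | Stay | Move_Right

type_synonym tape = "int \<Rightarrow> nat"

record tm =
  tm_tapes :: nat
  tm_symbols :: nat
  tm_states :: nat
  tm_delta :: "nat \<Rightarrow> nat list \<Rightarrow> nat \<times> (nat \<times> move) list"

definition well_formed_tm :: "tm \<Rightarrow> bool" where
  "well_formed_tm M \<longleftrightarrow> tm_tapes M \<ge> 1 \<and> tm_symbols M \<ge> 1 \<and>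
     (\<forall>q rs. q < tm_states M \<and> length rs = tm_tapes M \<and> set rs \<subseteq> {..<tm_symbols M} \<longrightarrow>
        (case tm_delta M q rs of (q', acts) \<Rightarrow>
           q' \<le> tm_states M \<and> length acts = tm_tapes M \<and> fst ` set acts \<subseteq> {..<tm_symbols M}))"

fun move_head :: "move \<Rightarrow> tape \<Rightarrow> tape" where
  "move_head Move_Left t = (\<lambda>i. t (i - 1))"
| "move_head Stay t = t"
| "move_head Move_Right t = (\<lambda>i. t (i + 1))"

definition act :: "nat \<times> move \<Rightarrow> tape \<Rightarrow> tape" where
  "act = (\<lambda>(s, m) t. move_head m (t(0 := s)))"

definition tm_step :: "tm \<Rightarrow> nat \<times> tape list \<Rightarrow> nat \<times> tape list" where
  "tm_step M = (\<lambda>(q, ts).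
     if q < tm_states M then
       case tm_delta M q (map (\<lambda>t. t 0) ts) of (q', acts) \<Rightarrow> (q', map2 act acts ts)
     else (q, ts))"

definition word_tape :: "nat list \<Rightarrow> tape" where
  "word_tape w = (\<lambda>i. if 0 \<le> i \<and> i < int (length w) then w ! nat i else 0)"

definition tm_init :: "tm \<Rightarrow> nat list \<Rightarrow> nat \<times> tape list" where
  "tm_init M w = (0, word_tape w # replicate (tm_tapes M - 1) (word_tape []))"

definition tm_computes_within :: "tm \<Rightarrow> nat list \<Rightarrow> nat \<Rightarrow> nat list \<Rightarrow> bool" where
  "tm_computes_within M w T v \<longleftrightarrow>
     (\<exists>t\<le>T. \<exists>ts. (tm_step M ^^ t) (tm_init M w) = (tm_states M, word_tape v # ts))"

text \<open>
  Instances are handed to a machine as words over \<open>{1..}\<close>; polynomial time is measured in the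
  length of this word. Nothing is required of the machine on words that encode no instance.
\<close>

definition poly_time_computable ::
  "'a set \<Rightarrow> ('a \<Rightarrow> nat list) \<Rightarrow> ('b \<Rightarrow> nat list) \<Rightarrow> ('a \<Rightarrow> 'b) \<Rightarrow> bool" where
  "poly_time_computable I enc enc' f \<longleftrightarrow>
     (\<exists>M (p :: nat poly). well_formed_tm M \<and>
        (\<forall>u\<in>I. set (enc u) \<subseteq> {1..<tm_symbols M} \<and>
           tm_computes_within M (enc u) (poly p (length (enc u))) (enc' (f u))))"

record 'a problem =
  instances :: "'a set"
  positives :: "'a set"
  encoding :: "'a \<Rightarrow> nat list"

definition P_reducible :: "'a problem \<Rightarrow> 'b problem \<Rightarrow> bool" (infix \<open>\<le>\<^sub>P\<close> 50) where
  "A \<le>\<^sub>P B \<longleftrightarrow>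
     (\<exists>f. f \<in> instances A \<rightarrow> instances B \<and>
        poly_time_computable (instances A) (encoding A) (encoding B) f \<and>
        (\<forall>u\<in>instances A. u \<in> positives A \<longleftrightarrow> f u \<in> positives B))"


section \<open>Monoid presentations, free products and free groups\<close>

inductive_set pres_cong :: "'a set \<Rightarrow> ('a list \<times> 'a list) set \<Rightarrow> ('a list \<times> 'a list) set"
  for A R where
  base: "(u, v) \<in> R \<Longrightarrow> u \<in> lists A \<Longrightarrow> v \<in> lists A \<Longrightarrow> (u, v) \<in> pres_cong A R"
| refl: "u \<in> lists A \<Longrightarrow> (u, u) \<in> pres_cong A R"
| sym: "(u, v) \<in> pres_cong A R \<Longrightarrow> (v, u) \<in> pres_cong A R"
| trans: "(u, v) \<in> pres_cong A R \<Longrightarrow> (v, w) \<in> pres_cong A R \<Longrightarrow> (u, w) \<in> pres_cong A R"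
| append: "(u, u') \<in> pres_cong A R \<Longrightarrow> (v, v') \<in> pres_cong A R \<Longrightarrow> (u @ v, u' @ v') \<in> pres_cong A R"

definition presented_monoid :: "'a set \<Rightarrow> ('a list \<times> 'a list) set \<Rightarrow> 'a list set monoid" where
  "presented_monoid A R =
     \<lparr>carrier = lists A // pres_cong A R,
      monoid.mult = (\<lambda>P Q. \<Union>u\<in>P. \<Union>v\<in>Q. pres_cong A R `` {u @ v}),
      monoid.one = pres_cong A R `` {[]}\<rparr>"

definition fp_relators ::
  "('a, 'm) monoid_scheme \<Rightarrow> ('b, 'n) monoid_scheme \<Rightarrow> (('a + 'b) list \<times> ('a + 'b) list) set" where
  "fp_relators G H =
     {([Inl x, Inl y], [Inl (x \<otimes>\<^bsub>G\<^esub> y)]) | x y. x \<in> carrier G \<and> y \<in> carrier G} \<union>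
     {([Inr x, Inr y], [Inr (x \<otimes>\<^bsub>H\<^esub> y)]) | x y. x \<in> carrier H \<and> y \<in> carrier H} \<union>
     {([Inl \<one>\<^bsub>G\<^esub>], []), ([Inr \<one>\<^bsub>H\<^esub>], [])}"

definition free_product ::
  "('a, 'm) monoid_scheme \<Rightarrow> ('b, 'n) monoid_scheme \<Rightarrow> ('a + 'b) list set monoid" where
  "free_product G H = presented_monoid (carrier G <+> carrier H) (fp_relators G H)"

text \<open>The letter \<open>(s, True)\<close> stands for \<open>s\<close> and \<open>(s, False)\<close> for its formal inverse.\<close>

definition free_group :: "'s set \<Rightarrow> ('s \<times> bool) list set monoid" where
  "free_group S = presented_monoid (S \<times> UNIV) {([(s, b), (s, \<not> b)], []) | s b. s \<in> S}"

definition F\<^sub>2 :: "(bool \<times> bool) list set monoid" where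
  "F\<^sub>2 = free_group (UNIV :: bool set)"


section \<open>Words over a finite generating family\<close>

text \<open>
  A finite generating set is enumerated as a list \<open>xs\<close>; its letters are the indices
  \<open>i < length xs\<close>. For a group, a finite set \<open>X\<close> of group generators gives the family
  enumerating \<open>X \<union> X\<^sup>-\<^sup>1\<close>.
\<close>

type_synonym gword = "nat list"

definition words :: "'a list \<Rightarrow> gword set" where
  "words xs = lists {..<length xs}"

definition list_prod :: "('a, 'm) monoid_scheme \<Rightarrow> 'a list \<Rightarrow> 'a" where
  "list_prod K as = foldr (\<otimes>\<^bsub>K\<^esub>) as \<one>\<^bsub>K\<^esub>"

definition word_val :: "('a, 'm) monoid_scheme \<Rightarrow> 'a list \<Rightarrow> gword \<Rightarrow> 'a" where
  "word_val K xs w = list_prod K (map (\<lambda>i. xs ! i) w)"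

definition generating_family :: "('a, 'm) monoid_scheme \<Rightarrow> 'a list \<Rightarrow> bool" where
  "generating_family K xs \<longleftrightarrow>
     set xs \<subseteq> carrier K \<and> (\<forall>x\<in>carrier K. \<exists>w\<in>words xs. word_val K xs w = x)"

text \<open>Symbols of encodings: \<open>1\<close> is a separator, \<open>2\<close> a unary digit, \<open>i + 3\<close> the letter \<open>i\<close>.\<close>

definition enc_word :: "gword \<Rightarrow> nat list" where
  "enc_word w = map (\<lambda>i. i + 3) w"

definition enc_unary :: "nat \<Rightarrow> nat list" where
  "enc_unary n = replicate n 2"


section \<open>The subset sum problem\<close>

text \<open>An instance \<open>(ws, w)\<close> consists of words for \<open>g\<^sub>1, \<dots>, g\<^sub>k\<close> and a word for \<open>g\<close>.\<close>

type_synonym ssp_instance = "gword list \<times> gword"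

definition SSP :: "('a, 'm) monoid_scheme \<Rightarrow> 'a list \<Rightarrow> ssp_instance problem" where
  "SSP K xs =
     \<lparr>instances = lists (words xs) \<times> words xs,
      positives = {(ws, w). ws \<in> lists (words xs) \<and> w \<in> words xs \<and>
        (\<exists>es :: nat list. length es = length ws \<and> set es \<subseteq> {0, 1} \<and>
           word_val K xs w = list_prod K (map2 (\<lambda>v e. word_val K xs v [^]\<^bsub>K\<^esub> e) ws es))},
      encoding = (\<lambda>(ws, w). concat (map (\<lambda>v. enc_word v @ [1]) (ws @ [w])))\<rparr>"


section \<open>The acyclic graph word problem\<close>

text \<open>
  The vertices are \<open>{..<ag_order \<Gamma>}\<close>. An edge \<open>(u, l, v)\<close> leads from \<open>u\<close> to \<open>v\<close>; the label \<open>None\<close>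
  is the empty word. Parallel edges are allowed.
\<close>

type_synonym edge = "nat \<times> nat option \<times> nat"

record agwp_instance =
  ag_order :: nat
  ag_edges :: "edge list"
  ag_source :: nat
  ag_target :: nat
  ag_word :: gword

definition label_word :: "nat option \<Rightarrow> gword" where
  "label_word l = (case l of None \<Rightarrow> [] | Some i \<Rightarrow> [i])"

inductive labelled_path :: "edge set \<Rightarrow> nat \<Rightarrow> gword \<Rightarrow> nat \<Rightarrow> bool" for E where
  empty: "labelled_path E u [] u"
| step: "(u, l, v) \<in> E \<Longrightarrow> labelled_path E v w z \<Longrightarrow> labelled_path E u (label_word l @ w) z"

text \<open>
  Vertex names are written in unary. Since they are smaller than the number of vertices, which
  is itself part of the size of the graph, this changes the size of an instance only
  polynomially.
\<close>

definition enc_edge :: "edge \<Rightarrow> nat list" where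
  "enc_edge = (\<lambda>(u, l, v).
     enc_unary u @ [1] @ enc_word (label_word l) @ [1] @ enc_unary v @ [1])"

definition enc_agwp :: "agwp_instance \<Rightarrow> nat list" where
  "enc_agwp \<Gamma> =
     enc_unary (ag_order \<Gamma>) @ [1] @ enc_unary (ag_source \<Gamma>) @ [1] @
     enc_unary (ag_target \<Gamma>) @ [1] @ enc_word (ag_word \<Gamma>) @ [1] @
     concat (map enc_edge (ag_edges \<Gamma>))"

definition agwp_instances :: "'a list \<Rightarrow> agwp_instance set" where
  "agwp_instances xs = {\<Gamma>.
     (\<forall>(u, l, v)\<in>set (ag_edges \<Gamma>).
        u < ag_order \<Gamma> \<and> v < ag_order \<Gamma> \<and> label_word l \<in> words xs) \<and>
     acyclic {(u, v). \<exists>l. (u, l, v) \<in> set (ag_edges \<Gamma>)} \<and>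
     ag_source \<Gamma> < ag_order \<Gamma> \<and> ag_target \<Gamma> < ag_order \<Gamma> \<and> ag_word \<Gamma> \<in> words xs}"

definition AGWP :: "('a, 'm) monoid_scheme \<Rightarrow> 'a list \<Rightarrow> agwp_instance problem" where
  "AGWP K xs =
     \<lparr>instances = agwp_instances xs,
      positives = {\<Gamma> \<in> agwp_instances xs.
        \<exists>w. labelled_path (set (ag_edges \<Gamma>)) (ag_source \<Gamma>) w (ag_target \<Gamma>) \<and>
            word_val K xs w = word_val K xs (ag_word \<Gamma>)},
      encoding = enc_agwp\<rparr>"


section \<open>Basic properties of the constructions\<close>

lemma pres_cong_equiv: "equiv (lists A) (pres_cong A R)"
proof -
  have sub: "u \<in> lists A \<and> v \<in> lists A" if "(u, v) \<in> pres_cong A R" for u v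
    using that by induction auto
  have "pres_cong A R \<subseteq> lists A \<times> lists A"
    by (rule subrelI) (simp only: mem_Sigma_iff sub)
  moreover have "refl_on (lists A) (pres_cong A R)"
    by (rule refl_onI) (rule pres_cong.refl)
  moreover have "sym (pres_cong A R)" by (rule symI) (rule pres_cong.sym)
  moreover have "trans (pres_cong A R)" by (rule transI) (rule pres_cong.trans)
  ultimately show ?thesis unfolding equiv_def by blast
qed

lemma presented_monoid_mult:
  assumes "u \<in> lists A" "v \<in> lists A"
  shows "pres_cong A R `` {u} \<otimes>\<^bsub>presented_monoid A R\<^esub> pres_cong A R `` {v} =
    pres_cong A R `` {u @ v}"
proof -
  note eq = pres_cong_equiv[of A R]
  let ?C = "pres_cong A R"
  have same: "?C `` {u' @ v'} = ?C `` {u @ v}" if "u' \<in> ?C `` {u}" "v' \<in> ?C `` {v}" for u' v'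
  proof -
    have "(u @ v, u' @ v') \<in> ?C" using that by (intro pres_cong.append) simp_all
    from equiv_class_eq[OF eq this] show ?thesis by simp
  qed
  have "u \<in> ?C `` {u}" "v \<in> ?C `` {v}"
    using assms by (simp_all only: Image_singleton_iff pres_cong.refl)
  then have ne: "?C `` {u} \<noteq> {}" "?C `` {v} \<noteq> {}" by (metis empty_iff)+
  have "(\<Union>u'\<in>?C `` {u}. \<Union>v'\<in>?C `` {v}. ?C `` {u' @ v'}) =
      (\<Union>u'\<in>?C `` {u}. \<Union>v'\<in>?C `` {v}. ?C `` {u @ v})"
    by (intro SUP_cong HOL.refl same)
  also have "\<dots> = ?C `` {u @ v}" by (simp only: UN_constant ne if_False)
  finally show ?thesis by (simp only: presented_monoid_def monoid.simps)
qed

lemma presented_monoid_one: "\<one>\<^bsub>presented_monoid A R\<^esub> = pres_cong A R `` {[]}"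
  by (simp add: presented_monoid_def)

lemma presented_monoid_carrier:
  "x \<in> carrier (presented_monoid A R) \<longleftrightarrow> (\<exists>u\<in>lists A. x = pres_cong A R `` {u})"
  by (auto simp: presented_monoid_def quotient_def)

lemma presented_monoid_monoid: "monoid (presented_monoid A R)"
proof (rule monoidI)
  let ?M = "presented_monoid A R"
  note mult = presented_monoid_mult[of _ A _ R]
  show "\<one>\<^bsub>?M\<^esub> \<in> carrier ?M"
    unfolding presented_monoid_carrier presented_monoid_one by blast
  fix x y z
  assume "x \<in> carrier ?M"
  then obtain u where u: "u \<in> lists A" "x = pres_cong A R `` {u}"
    unfolding presented_monoid_carrier by blast
  show "\<one>\<^bsub>?M\<^esub> \<otimes>\<^bsub>?M\<^esub> x = x" "x \<otimes>\<^bsub>?M\<^esub> \<one>\<^bsub>?M\<^esub> = x"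
    unfolding u(2) presented_monoid_one
    using mult[OF lists.Nil u(1)] mult[OF u(1) lists.Nil] by simp_all
  assume "y \<in> carrier ?M"
  then obtain v where v: "v \<in> lists A" "y = pres_cong A R `` {v}"
    unfolding presented_monoid_carrier by blast
  have uv: "u @ v \<in> lists A" using u(1) v(1) by simp
  show "x \<otimes>\<^bsub>?M\<^esub> y \<in> carrier ?M"
    unfolding u(2) v(2) mult[OF u(1) v(1)] presented_monoid_carrier using uv by blast
  assume "z \<in> carrier ?M"
  then obtain w where w: "w \<in> lists A" "z = pres_cong A R `` {w}"
    unfolding presented_monoid_carrier by blast
  have vw: "v @ w \<in> lists A" using v(1) w(1) by simp
  show "x \<otimes>\<^bsub>?M\<^esub> y \<otimes>\<^bsub>?M\<^esub> z = x \<otimes>\<^bsub>?M\<^esub> (y \<otimes>\<^bsub>?M\<^esub> z)"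
    unfolding u(2) v(2) w(2) mult[OF u(1) v(1)] mult[OF v(1) w(1)]
      mult[OF uv w(1)] mult[OF u(1) vw] by simp
qed

lemma free_product_monoid: "monoid (free_product G H)"
  unfolding free_product_def by (rule presented_monoid_monoid)

lemma free_group_group: "group (free_group S)"
proof (rule group.intro)
  show "monoid (free_group S)"
    unfolding free_group_def by (rule presented_monoid_monoid)
next
  let ?R = "{([(s, b), (s, \<not> b)], []) | s b. s \<in> S}"
  let ?c = "pres_cong (S \<times> (UNIV :: bool set)) ?R"
  let ?A = "lists (S \<times> (UNIV :: bool set))"
  have inv: "\<exists>v\<in>?A. (u @ v, []) \<in> ?c \<and> (v @ u, []) \<in> ?c" if "u \<in> ?A" for u
    using that
  proof (induction u)
    case Nil
    show ?case by (auto intro!: bexI[of _ "[]"] pres_cong.refl)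
  next
    case (Cons a u)
    obtain s b where a: "a = (s, b)" and s: "s \<in> S" using Cons by auto
    obtain v where v: "v \<in> ?A" "(u @ v, []) \<in> ?c" "(v @ u, []) \<in> ?c" using Cons by auto
    let ?w = "v @ [(s, \<not> b)]"
    have c1: "([(s, b), (s, \<not> b)], []) \<in> ?c" using s by (intro pres_cong.base) auto
    have "([(s, \<not> b), (s, \<not> \<not> b)], []) \<in> ?c"
      using s by (intro pres_cong.base CollectI exI[of _ s] exI[of _ "\<not> b"]) auto
    then have c2: "([(s, \<not> b), (s, b)], []) \<in> ?c" by simp
    have r: "([(s, c)], [(s, c)]) \<in> ?c" for c using s by (intro pres_cong.refl) auto
    have "([(s, b)] @ (u @ v) @ [(s, \<not> b)], [(s, b)] @ [] @ [(s, \<not> b)]) \<in> ?c"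
      by (intro pres_cong.append r v(2))
    then have 1: "((a # u) @ ?w, []) \<in> ?c"
      using c1 by (auto simp: a intro: pres_cong.trans)
    have "(v @ [(s, \<not> b), (s, b)] @ u, v @ [] @ u) \<in> ?c"
      using v(1) Cons.hyps by (intro pres_cong.append c2 pres_cong.refl)
    then have 2: "(?w @ (a # u), []) \<in> ?c"
      using v(3) by (auto simp: a intro: pres_cong.trans)
    have "?w \<in> ?A" using v(1) s by auto
    with 1 2 show ?case by blast
  qed
  show "group_axioms (free_group S)"
  proof
    show "carrier (free_group S) \<subseteq> Units (free_group S)"
    proof
      fix x assume "x \<in> carrier (free_group S)"
      then obtain u where u: "u \<in> ?A" "x = ?c `` {u}"
        unfolding free_group_def presented_monoid_carrier by blast
      obtain v where v: "v \<in> ?A" "(u @ v, []) \<in> ?c" "(v @ u, []) \<in> ?c"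
        using inv[OF u(1)] by blast
      note eq = equiv_class_eq[OF pres_cong_equiv]
      have "?c `` {v} \<otimes>\<^bsub>free_group S\<^esub> x = \<one>\<^bsub>free_group S\<^esub>"
        "x \<otimes>\<^bsub>free_group S\<^esub> ?c `` {v} = \<one>\<^bsub>free_group S\<^esub>"
        unfolding free_group_def u(2) presented_monoid_one
          presented_monoid_mult[OF u(1) v(1)] presented_monoid_mult[OF v(1) u(1)]
        by (rule eq[OF v(3)], rule eq[OF v(2)])
      moreover have "?c `` {v} \<in> carrier (free_group S)"
        unfolding free_group_def presented_monoid_carrier using v(1) by blast
      ultimately show "x \<in> Units (free_group S)"
        using \<open>x \<in> carrier (free_group S)\<close> unfolding Units_def by blast
    qed
  qed
qed

lemma list_prod_closed:
  assumes "monoid K" "set as \<subseteq> carrier K"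
  shows "list_prod K as \<in> carrier K"
  using assms(2) by (induction as) (auto simp: list_prod_def
      monoid.m_closed[OF assms(1)] monoid.one_closed[OF assms(1)])

lemma list_prod_append:
  assumes "monoid K" "set as \<subseteq> carrier K" "set bs \<subseteq> carrier K"
  shows "list_prod K (as @ bs) = list_prod K as \<otimes>\<^bsub>K\<^esub> list_prod K bs"
  using assms(2)
proof (induction as)
  case Nil
  show ?case
    using monoid.l_one[OF assms(1) list_prod_closed[OF assms(1,3)]] by (simp add: list_prod_def)
next
  case (Cons a as)
  then show ?case
    using monoid.m_assoc[OF assms(1), of a "list_prod K as" "list_prod K bs"]
      list_prod_closed[OF assms(1)] assms(3)
    by (simp add: list_prod_def)
qed

text \<open>
  Generation by a finite set, without an enumeration, and existence of the families needed for
  the two products with \<open>F\<^sub>2\<close>.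
\<close>

definition gen_by :: "('a, 'm) monoid_scheme \<Rightarrow> 'a set \<Rightarrow> bool" where
  "gen_by K X \<longleftrightarrow> X \<subseteq> carrier K \<and> carrier K \<subseteq> list_prod K ` lists X"

lemma generating_family_iff: "generating_family K xs \<longleftrightarrow> gen_by K (set xs)"
proof -
  have "(\<lambda>w. map ((!) xs) w) ` words xs = lists (set xs)"
  proof -
    have "(!) xs ` {..<length xs} = set xs"
      by (auto simp: set_conv_nth)
    then show ?thesis unfolding words_def by (metis lists_image)
  qed
  then have "list_prod K ` lists (set xs) = word_val K xs ` words xs"
    unfolding word_val_def by (metis image_image)
  then show ?thesis
    unfolding generating_family_def gen_by_def by (auto simp: image_iff)
qed

lemma gen_byI:
  assumes "monoid K" "X \<subseteq> carrier K"
    and "\<And>x. x \<in> carrier K \<Longrightarrow> \<exists>as. set as \<subseteq> list_prod K ` lists X \<and> x = list_prod K as"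
  shows "gen_by K X"
proof -
  have "list_prod K as \<in> list_prod K ` lists X" if "set as \<subseteq> list_prod K ` lists X" for as
    using that
  proof (induction as)
    case Nil
    show ?case by (rule imageI) simp
  next
    case (Cons a as)
    then obtain bs cs where b: "bs \<in> lists X" "a = list_prod K bs"
      and c: "cs \<in> lists X" "list_prod K as = list_prod K cs" by auto
    have "set bs \<subseteq> carrier K" "set cs \<subseteq> carrier K" using b(1) c(1) assms(2) by auto
    then have "list_prod K (a # as) = list_prod K (bs @ cs)"
      using b(2) c(2) list_prod_append[OF assms(1)] by (simp add: list_prod_def)
    then show ?case using b(1) c(1) by (intro image_eqI[of _ _ "bs @ cs"]) auto
  qed
  then show ?thesis unfolding gen_by_def using assms(2,3) by blast
qed

lemma presented_monoid_list_prod: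
  assumes "u \<in> lists A"
  shows "list_prod (presented_monoid A R) (map (\<lambda>a. pres_cong A R `` {[a]}) u) =
    pres_cong A R `` {u}"
  using assms
proof induction
  case Nil
  show ?case by (simp add: list_prod_def presented_monoid_one)
next
  case (Cons a u)
  have "[a] \<in> lists A" using Cons.hyps by simp
  from presented_monoid_mult[OF this Cons.hyps(2), of R] Cons.IH show ?case
    by (simp add: list_prod_def)
qed

lemma gen_by_presented_monoid:
  "gen_by (presented_monoid A R) ((\<lambda>a. pres_cong A R `` {[a]}) ` A)"
proof -
  define h where "h = (\<lambda>a. pres_cong A R `` {[a]})"
  have "h a \<in> carrier (presented_monoid A R)" if "a \<in> A" for a
  proof -
    have "[a] \<in> lists A" using that by simp
    then show ?thesis unfolding h_def presented_monoid_carrier by (intro bexI[of _ "[a]"] HOL.refl)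
  qed
  moreover have "x \<in> list_prod (presented_monoid A R) ` lists (h ` A)"
    if x: "x \<in> carrier (presented_monoid A R)" for x
  proof -
    obtain u where u: "u \<in> lists A" "x = pres_cong A R `` {u}"
      using x unfolding presented_monoid_carrier by blast
    have "x = list_prod (presented_monoid A R) (map h u)"
      unfolding u(2) h_def by (rule presented_monoid_list_prod[OF u(1), symmetric])
    moreover have "map h u \<in> lists (h ` A)" unfolding lists_image using u(1) by (rule imageI)
    ultimately show ?thesis by (rule image_eqI)
  qed
  ultimately show ?thesis
    unfolding gen_by_def h_def[symmetric] by (intro conjI image_subsetI subsetI)
qed

lemma list_prod_hom:
  assumes "h \<in> hom K L" "h \<one>\<^bsub>K\<^esub> = \<one>\<^bsub>L\<^esub>" "monoid K" "set as \<subseteq> carrier K"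
  shows "h (list_prod K as) = list_prod L (map h as)"
  using assms(4)
proof (induction as)
  case Nil
  show ?case using assms(2) by (simp add: list_prod_def)
next
  case (Cons a as)
  then show ?case
    using hom_mult[OF assms(1), of a "list_prod K as"] list_prod_closed[OF assms(3), of as]
    by (simp add: list_prod_def)
qed

lemma gen_by_hom_image:
  assumes "h \<in> hom K L" "h \<one>\<^bsub>K\<^esub> = \<one>\<^bsub>L\<^esub>" "monoid K" "gen_by K X" "x \<in> carrier K" "h ` X \<subseteq> Y"
  shows "h x \<in> list_prod L ` lists Y"
proof -
  obtain as where as: "as \<in> lists X" "x = list_prod K as"
    using assms(4,5) unfolding gen_by_def by blast
  have "h x = list_prod L (map h as)"
    unfolding as(2) using as(1) assms(4) unfolding gen_by_def
    by (intro list_prod_hom assms(1-3)) auto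
  moreover have "map h as \<in> lists Y" using as(1) assms(6) by (auto simp: image_subset_iff)
  ultimately show ?thesis by blast
qed

definition fp_incl ::
  "('a, 'm) monoid_scheme \<Rightarrow> ('b, 'n) monoid_scheme \<Rightarrow> 'a + 'b \<Rightarrow> ('a + 'b) list set" where
  "fp_incl G H a = pres_cong (carrier G <+> carrier H) (fp_relators G H) `` {[a]}"

lemma fp_incl_hom:
  assumes "monoid G" "monoid H"
  shows "(\<lambda>x. fp_incl G H (Inl x)) \<in> hom G (free_product G H)"
    "(\<lambda>x. fp_incl G H (Inr x)) \<in> hom H (free_product G H)"
    "fp_incl G H (Inl \<one>\<^bsub>G\<^esub>) = \<one>\<^bsub>free_product G H\<^esub>"
    "fp_incl G H (Inr \<one>\<^bsub>H\<^esub>) = \<one>\<^bsub>free_product G H\<^esub>"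
proof -
  let ?A = "carrier G <+> carrier H" and ?R = "fp_relators G H"
  note eq = equiv_class_eq[OF pres_cong_equiv, of _ _ ?A ?R]
  have L: "[Inl x] \<in> lists ?A" if "x \<in> carrier G" for x using that by auto
  have R: "[Inr x] \<in> lists ?A" if "x \<in> carrier H" for x using that by auto
  show "(\<lambda>x. fp_incl G H (Inl x)) \<in> hom G (free_product G H)"
  proof (rule homI)
    fix x assume x: "x \<in> carrier G"
    then show "fp_incl G H (Inl x) \<in> carrier (free_product G H)"
      unfolding fp_incl_def free_product_def presented_monoid_carrier using L by blast
    fix y assume y: "y \<in> carrier G"
    have "([Inl x, Inl y], [Inl (x \<otimes>\<^bsub>G\<^esub> y)]) \<in> pres_cong ?A ?R"
      using x y monoid.m_closed[OF assms(1) x y]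
      by (intro pres_cong.base) (auto simp: fp_relators_def)
    from eq[OF this]
    show "fp_incl G H (Inl (x \<otimes>\<^bsub>G\<^esub> y)) =
        fp_incl G H (Inl x) \<otimes>\<^bsub>free_product G H\<^esub> fp_incl G H (Inl y)"
      unfolding fp_incl_def free_product_def presented_monoid_mult[OF L[OF x] L[OF y]] by simp
  qed
  show "(\<lambda>x. fp_incl G H (Inr x)) \<in> hom H (free_product G H)"
  proof (rule homI)
    fix x assume x: "x \<in> carrier H"
    then show "fp_incl G H (Inr x) \<in> carrier (free_product G H)"
      unfolding fp_incl_def free_product_def presented_monoid_carrier using R by blast
    fix y assume y: "y \<in> carrier H"
    have "([Inr x, Inr y], [Inr (x \<otimes>\<^bsub>H\<^esub> y)]) \<in> pres_cong ?A ?R"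
      using x y monoid.m_closed[OF assms(2) x y]
      by (intro pres_cong.base) (auto simp: fp_relators_def)
    from eq[OF this]
    show "fp_incl G H (Inr (x \<otimes>\<^bsub>H\<^esub> y)) =
        fp_incl G H (Inr x) \<otimes>\<^bsub>free_product G H\<^esub> fp_incl G H (Inr y)"
      unfolding fp_incl_def free_product_def presented_monoid_mult[OF R[OF x] R[OF y]] by simp
  qed
  have "([Inl \<one>\<^bsub>G\<^esub>], []) \<in> pres_cong ?A ?R" "([Inr \<one>\<^bsub>H\<^esub>], []) \<in> pres_cong ?A ?R"
    using monoid.one_closed[OF assms(1)] monoid.one_closed[OF assms(2)]
    by (intro pres_cong.base; auto simp: fp_relators_def)+
  from eq[OF this(1)] eq[OF this(2)]
  show "fp_incl G H (Inl \<one>\<^bsub>G\<^esub>) = \<one>\<^bsub>free_product G H\<^esub>"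
    "fp_incl G H (Inr \<one>\<^bsub>H\<^esub>) = \<one>\<^bsub>free_product G H\<^esub>"
    unfolding fp_incl_def free_product_def presented_monoid_one by auto
qed

lemma gen_by_free_product:
  assumes "monoid G" "monoid H" "gen_by G X" "gen_by H Y"
  shows "gen_by (free_product G H) (fp_incl G H ` (X <+> Y))" (is "gen_by ?P ?Z")
proof (rule gen_byI[OF free_product_monoid])
  note incl = fp_incl_hom[OF assms(1,2)]
  show "?Z \<subseteq> carrier ?P"
    using hom_in_carrier[OF incl(1)] hom_in_carrier[OF incl(2)] assms(3,4)
    unfolding gen_by_def by (auto simp: subset_iff)
  have l: "fp_incl G H (Inl x) \<in> list_prod ?P ` lists ?Z" if "x \<in> carrier G" for x
    by (rule gen_by_hom_image[OF incl(1) incl(3) assms(1,3) that]) auto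
  have r: "fp_incl G H (Inr x) \<in> list_prod ?P ` lists ?Z" if "x \<in> carrier H" for x
    by (rule gen_by_hom_image[OF incl(2) incl(4) assms(2,4) that]) auto
  fix x assume "x \<in> carrier ?P"
  then obtain u where u: "u \<in> lists (carrier G <+> carrier H)"
    "x = pres_cong (carrier G <+> carrier H) (fp_relators G H) `` {u}"
    unfolding free_product_def presented_monoid_carrier by blast
  have "x = list_prod ?P (map (fp_incl G H) u)"
    unfolding u(2) free_product_def fp_incl_def
    by (rule presented_monoid_list_prod[OF u(1), symmetric])
  moreover have "set (map (fp_incl G H) u) \<subseteq> list_prod ?P ` lists ?Z"
    using u(1) l r by auto
  ultimately show "\<exists>as. set as \<subseteq> list_prod ?P ` lists ?Z \<and> x = list_prod ?P as" by blast
qed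

lemma gen_by_DirProd:
  assumes "monoid G" "monoid H" "gen_by G X" "gen_by H Y"
  shows "gen_by (G \<times>\<times> H) ((\<lambda>x. (x, \<one>\<^bsub>H\<^esub>)) ` X \<union> (\<lambda>y. (\<one>\<^bsub>G\<^esub>, y)) ` Y)" (is "gen_by ?P ?Z")
proof (rule gen_byI[OF DirProd_monoid[OF assms(1,2)]])
  interpret G: monoid G by fact
  interpret H: monoid H by fact
  show "?Z \<subseteq> carrier ?P"
    using assms(3,4) unfolding gen_by_def by auto
  fix x assume "x \<in> carrier ?P"
  then obtain g h where x: "x = (g, h)" "g \<in> carrier G" "h \<in> carrier H" by auto
  have "(g, \<one>\<^bsub>H\<^esub>) \<in> list_prod ?P ` lists ?Z"
    by (rule gen_by_hom_image[OF _ _ assms(1,3) x(2)]) (auto intro!: homI)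
  moreover have "(\<one>\<^bsub>G\<^esub>, h) \<in> list_prod ?P ` lists ?Z"
    by (rule gen_by_hom_image[OF _ _ assms(2,4) x(3)]) (auto intro!: homI)
  moreover have "x = list_prod ?P [(g, \<one>\<^bsub>H\<^esub>), (\<one>\<^bsub>G\<^esub>, h)]"
    using x by (simp add: list_prod_def)
  ultimately show "\<exists>as. set as \<subseteq> list_prod ?P ` lists ?Z \<and> x = list_prod ?P as"
    by (intro exI[of _ "[(g, \<one>\<^bsub>H\<^esub>), (\<one>\<^bsub>G\<^esub>, h)]"]) auto
qed

lemma generating_families_exist:
  assumes "monoid G" "generating_family G xs"
  shows "\<exists>ys. generating_family (free_product G F\<^sub>2) ys"
    and "\<exists>zs. generating_family (G \<times>\<times> F\<^sub>2) zs"
proof -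
  have F: "monoid F\<^sub>2"
    unfolding F\<^sub>2_def by (rule group.is_monoid[OF free_group_group])
  obtain Y where Y: "finite Y" "gen_by F\<^sub>2 Y"
    by (rule that[rotated], unfold F\<^sub>2_def free_group_def, rule gen_by_presented_monoid) simp
  have X: "gen_by G (set xs)" using assms(2) by (simp add: generating_family_iff)
  have "finite (fp_incl G F\<^sub>2 ` (set xs <+> Y))" using Y(1) by simp
  from finite_list[OF this] show "\<exists>ys. generating_family (free_product G F\<^sub>2) ys"
    using gen_by_free_product[OF assms(1) F X Y(2)] by (metis generating_family_iff)
  have "finite ((\<lambda>x. (x, \<one>\<^bsub>F\<^sub>2\<^esub>)) ` set xs \<union> (\<lambda>y. (\<one>\<^bsub>G\<^esub>, y)) ` Y)" using Y(1) by simp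
  from finite_list[OF this] show "\<exists>zs. generating_family (G \<times>\<times> F\<^sub>2) zs"
    using gen_by_DirProd[OF assms(1) F X Y(2)] by (metis generating_family_iff)
qed

lemma sep_cancel:
  assumes "x \<notin> set as" "x \<notin> set bs"
  shows "as @ x # cs = bs @ x # ds \<longleftrightarrow> as = bs \<and> cs = ds"
  using assms
proof (induction as arbitrary: bs)
  case Nil
  then show ?case by (cases bs) auto
next
  case (Cons a as)
  then show ?case by (cases bs) auto
qed

lemma not_in_enc: "Suc 0 \<notin> set (enc_word w)" "Suc 0 \<notin> set (enc_unary n)"
  by (auto simp: enc_word_def enc_unary_def)

lemma enc_word_eq: "enc_word v = enc_word w \<longleftrightarrow> v = w"
  unfolding enc_word_def by (rule inj_map_eq_map) (simp add: inj_def)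

lemma enc_unary_eq: "enc_unary m = enc_unary n \<longleftrightarrow> m = n"
  by (simp add: enc_unary_def)

lemma label_word_eq: "label_word l = label_word l' \<longleftrightarrow> l = l'"
  by (auto simp: label_word_def split: option.splits)

lemmas enc_eqs = sep_cancel not_in_enc enc_word_eq enc_unary_eq label_word_eq

lemma enc_edge_append_eq:
  "enc_edge e @ as = enc_edge e' @ bs \<longleftrightarrow> e = e' \<and> as = bs"
proof -
  obtain u l v where e: "e = (u, l, v)" by (rule prod_cases3)
  obtain u' l' v' where e': "e' = (u', l', v')" by (rule prod_cases3)
  show ?thesis
    unfolding e e' enc_edge_def by (simp add: enc_eqs)
qed

lemma enc_edges_eq: "concat (map enc_edge es) = concat (map enc_edge es') \<longleftrightarrow> es = es'"
proof (induction es arbitrary: es')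
  case Nil
  have "enc_edge e \<noteq> []" for e by (cases e) (simp add: enc_edge_def)
  then show ?case by (cases es') simp_all
next
  case (Cons e es)
  have "enc_edge e \<noteq> []" for e by (cases e) (simp add: enc_edge_def)
  then show ?case by (cases es') (simp_all add: enc_edge_append_eq Cons.IH)
qed

lemma enc_agwp_inj: "inj enc_agwp"
proof (rule injI)
  fix \<Gamma> \<Delta> assume "enc_agwp \<Gamma> = enc_agwp \<Delta>"
  then show "\<Gamma> = \<Delta>"
    unfolding enc_agwp_def by (intro agwp_instance.equality) (simp_all add: enc_eqs enc_edges_eq)
qed

lemma enc_words_eq:
  "concat (map (\<lambda>v. enc_word v @ [1]) vs) = concat (map (\<lambda>v. enc_word v @ [1]) ws) \<longleftrightarrow> vs = ws"
proof (induction vs arbitrary: ws)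
  case Nil
  show ?case by (cases ws) simp_all
next
  case (Cons v vs)
  then show ?case by (cases ws) (simp_all add: enc_eqs)
qed

lemma SSP_encoding_inj: "inj (encoding (SSP K xs))"
proof (rule injI)
  fix p q assume "encoding (SSP K xs) p = encoding (SSP K xs) q"
  then have "fst p @ [snd p] = fst q @ [snd q]"
    unfolding SSP_def problem.simps prod.case_eq_if enc_words_eq .
  then show "p = q" by (simp add: prod_eq_iff)
qed

end

theory Submission
  imports Defs "HOL-Library.Sublist"
begin

text \<open>
  Let \<open>x\<close>, \<open>y\<close> be the free generators of \<open>F\<^sub>2\<close> and \<open>z\<^sub>n = x\<^sup>n y x\<^sup>-\<^sup>n\<close>; the elements \<open>z\<^sub>0, z\<^sub>1, \<dots>\<close> are
  freely independent. An edge from \<open>u\<close> to \<open>v\<close> with label \<open>l\<close> is turned into \<open>z\<^sub>u l z\<^sub>v\<^sup>-\<^sup>1\<close>, and the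
  right-hand side of the subset sum instance is \<open>z\<^sub>\<alpha> w\<^sub>0 z\<^sub>\<omega>\<^sup>-\<^sup>1\<close>. Along a path the inner factors
  \<open>z\<^sub>v\<^sup>-\<^sup>1 z\<^sub>v\<close> cancel, so the edges of a path from \<open>\<alpha>\<close> to \<open>\<omega>\<close> with label \<open>w\<close> multiply to
  \<open>z\<^sub>\<alpha> w z\<^sub>\<omega>\<^sup>-\<^sup>1\<close> (\<open>edges_prod_walk\<close>). Conversely, cut an arbitrary sequence of edges into maximal
  walks. The graph is acyclic, so no nonempty walk ends where it starts, and the image of the
  product in \<open>F\<^sub>2\<close> is the reduced word in the \<open>z\<^sub>n\<close> that has one pair \<open>z\<^sub>s z\<^sub>t\<^sup>-\<^sup>1\<close> for each walk
  (\<open>trace_segments\<close>). It equals \<open>z\<^sub>\<alpha> z\<^sub>\<omega>\<^sup>-\<^sup>1\<close> only if the sequence is a single walk from \<open>\<alpha>\<close> to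
  \<open>\<omega>\<close> (\<open>trace_eq_imp_walk\<close>); the image in \<open>G\<close> then says that its label has the value of \<open>w\<^sub>0\<close>.
  The argument uses nothing but the homomorphisms between \<open>G\<close>, \<open>F\<^sub>2\<close> and the product, which is why
  one locale, \<open>free_rank_two_retract\<close>, serves the free and the direct product alike.

  The factors of a subset product come in a prescribed order, whereas the edges of a graph are
  listed in any order. Sorting them is avoided by repeating the whole list of edges: a path in an
  acyclic graph leaves each vertex at most once, so its \<open>k\<close>-th edge can be taken from the \<open>k\<close>-th
  copy (\<open>walk_length_le\<close>, \<open>subseq_concat_replicate\<close>). The number of copies is the length of the
  encoded graph, which is large enough and needs no arithmetic to be counted.

  Independence of the \<open>z\<^sub>n\<close> is seen from an action of \<open>F\<^sub>2\<close> on the reduced words over letters indexed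
  by the integers: \<open>x\<close> raises all indices by one and \<open>y\<close> multiplies by the letter \<open>0\<close> from the left,
  hence \<open>z\<^sub>n\<close> multiplies by the letter \<open>n\<close> (\<open>word_action_vertex_letters\<close>).

  Polynomial time is shown with a machine that has three tapes. It moves the input from the first
  tape to the other two. The head on the second tape sweeps over the input in both directions while
  the result is appended to the first tape: \<open>z\<^sub>n\<close> is written by running along the unary name of \<open>n\<close>
  forth, writing \<open>x\<close>, and back, writing \<open>x\<^sup>-\<^sup>1\<close>. The head on the third tape moves one cell to the left
  for every copy of the list of edges and thus counts the copies. The control of the machine is a
  stack of sweeps still to be made, together with the symbols still to be written
  (\<open>control_delta\<close>); \<open>finite_control_tm\<close> numbers its finitely many states.
\<close>

section \<open>Walks in a labelled graph\<close>

fun walk :: "nat \<Rightarrow> edge list \<Rightarrow> nat \<Rightarrow> bool" where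
  "walk u [] v \<longleftrightarrow> u = v"
| "walk u ((a, l, b) # es) v \<longleftrightarrow> a = u \<and> walk b es v"

definition walk_word :: "edge list \<Rightarrow> gword" where
  "walk_word es = concat (map (\<lambda>(u, l, v). label_word l) es)"

lemma walk_word_simps [simp]:
  "walk_word [] = []"
  "walk_word ((u, l, v) # es) = label_word l @ walk_word es"
  by (simp_all add: walk_word_def)

lemma labelled_path_iff_walk:
  "labelled_path E u w v \<longleftrightarrow> (\<exists>es. set es \<subseteq> E \<and> walk u es v \<and> w = walk_word es)"
proof
  assume "labelled_path E u w v"
  then show "\<exists>es. set es \<subseteq> E \<and> walk u es v \<and> w = walk_word es"
  proof induction
    case (empty u)
    show ?case by (rule exI[of _ "[]"]) simp
  next
    case (step u l v w z)
    then obtain es where "set es \<subseteq> E" "walk v es z" "w = walk_word es" by blast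
    with step.hyps(1) show ?case by (intro exI[of _ "(u, l, v) # es"]) simp
  qed
next
  assume "\<exists>es. set es \<subseteq> E \<and> walk u es v \<and> w = walk_word es"
  then obtain es where "set es \<subseteq> E" "walk u es v" "w = walk_word es" by blast
  then show "labelled_path E u w v"
  proof (induction es arbitrary: u w)
    case Nil
    then show ?case by (simp add: labelled_path.empty)
  next
    case (Cons e es)
    obtain a l b where e: "e = (a, l, b)" by (rule prod_cases3)
    with Cons show ?case by (auto intro!: labelled_path.step)
  qed
qed

definition arcs :: "edge set \<Rightarrow> (nat \<times> nat) set" where
  "arcs E = {(u, v). \<exists>l. (u, l, v) \<in> E}"

lemma walk_rtrancl: "set es \<subseteq> E \<Longrightarrow> walk u es v \<Longrightarrow> e \<in> set es \<Longrightarrow> (u, fst e) \<in> (arcs E)\<^sup>*"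
proof (induction es arbitrary: u)
  case (Cons a es)
  obtain x l y where a: "a = (x, l, y)" by (rule prod_cases3)
  have xy: "(x, y) \<in> arcs E" using Cons.prems(1) by (auto simp: a arcs_def)
  show ?case
  proof (cases "e = a")
    case True
    then show ?thesis using Cons.prems(2) a by simp
  next
    case False
    then have "(y, fst e) \<in> (arcs E)\<^sup>*" using Cons.IH[of y] Cons.prems a by simp
    with xy show ?thesis using Cons.prems(2) a by (simp add: converse_rtrancl_into_rtrancl)
  qed
qed simp

lemma walk_trancl: "set es \<subseteq> E \<Longrightarrow> walk u es v \<Longrightarrow> es \<noteq> [] \<Longrightarrow> (u, v) \<in> (arcs E)\<^sup>+"
proof (induction es arbitrary: u)
  case (Cons a es)
  obtain x l y where a: "a = (x, l, y)" by (rule prod_cases3)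
  have xy: "(x, y) \<in> arcs E" using Cons.prems(1) by (auto simp: a arcs_def)
  show ?case
  proof (cases "es = []")
    case True
    then show ?thesis using Cons.prems(2) a xy by auto
  next
    case False
    then have "(y, v) \<in> (arcs E)\<^sup>+" using Cons.IH[of y] Cons.prems a by simp
    with xy show ?thesis using Cons.prems(2) a by (simp add: trancl_into_trancl2)
  qed
qed simp

text \<open>
  A source that occurs twice would lie on a cycle.
\<close>

lemma walk_distinct_sources:
  assumes "acyclic (arcs E)" "set es \<subseteq> E" "walk u es v"
  shows "distinct (map fst es)"
  using assms(2,3)
proof (induction es arbitrary: u)
  case (Cons a es)
  obtain x l y where a: "a = (x, l, y)" by (rule prod_cases3)
  have xy: "(x, y) \<in> arcs E" using Cons.prems(1) by (auto simp: a arcs_def)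
  have "x \<noteq> fst e" if "e \<in> set es" for e
  proof
    assume "x = fst e"
    then have "(y, x) \<in> (arcs E)\<^sup>*" using walk_rtrancl[of es E y v e] Cons.prems that a by simp
    then have "(x, x) \<in> (arcs E)\<^sup>+" using xy by (rule rtrancl_into_trancl2[rotated])
    then show False using assms(1) by (simp add: acyclic_def)
  qed
  then show ?case using Cons.IH[of y] Cons.prems a by auto
qed simp

text \<open>
  The bound is the number of edges rather than of vertices, because every edge takes up space in the
  encoding of the graph.
\<close>

lemma walk_length_le:
  assumes "acyclic (arcs (set es))" "set p \<subseteq> set es" "walk u p v"
  shows "length p \<le> length es"
proof -
  have "length p = card (fst ` set p)"
    using distinct_card[OF walk_distinct_sources[OF assms]] by simp
  also have "\<dots> \<le> card (fst ` set es)" using assms(2) by (intro card_mono) auto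
  also have "\<dots> \<le> length es"
    by (rule order_trans[OF card_image_le card_length]) simp
  finally show ?thesis .
qed

text \<open>
  The \<open>k\<close>-th entry of \<open>p\<close> is picked from the \<open>k\<close>-th copy of \<open>es\<close>.
\<close>

lemma subseq_concat_replicate:
  assumes "set p \<subseteq> set es" "length p \<le> n"
  shows "subseq p (concat (replicate n es))"
  using assms
proof (induction n arbitrary: p)
  case (Suc n)
  show ?case
  proof (cases p)
    case (Cons e q)
    have "subseq [e] es" using Suc.prems(1) Cons by (simp add: subseq_singleton_left)
    moreover have "subseq q (concat (replicate n es))" using Suc Cons by simp
    ultimately have "subseq ([e] @ q) (es @ concat (replicate n es))" by (rule list_emb_append_mono)
    then show ?thesis using Cons by simp
  qed simp
qed simp

section \<open>Subset products\<close>

text \<open>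
  An exponent \<open>0\<close> drops a factor and an exponent \<open>1\<close> keeps it, so the vectors of exponents describe
  the products over subsequences.
\<close>

lemma subset_product_iff_subseq:
  assumes "monoid K" "set (map f ws) \<subseteq> carrier K"
  shows "(\<exists>es :: nat list. length es = length ws \<and> set es \<subseteq> {0, 1} \<and>
      x = list_prod K (map2 (\<lambda>v e. f v [^]\<^bsub>K\<^esub> e) ws es)) \<longleftrightarrow>
    (\<exists>vs. subseq vs ws \<and> x = list_prod K (map f vs))"
  using assms(2)
proof (induction ws arbitrary: x)
  case Nil
  show ?case by (simp add: list_emb_Nil2 conj_commute cong: conj_cong) (metis list.simps(8)
      list_emb_Nil list_emb_Nil2)
next
  case (Cons w ws)
  interpret monoid K by fact
  let ?P = "\<lambda>x ws es. length (es :: nat list) = length ws \<and> set es \<subseteq> {0, 1} \<and>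
      x = list_prod K (map2 (\<lambda>v e. f v [^]\<^bsub>K\<^esub> e) ws es)"
  have w: "f w \<in> carrier K" "set (map f ws) \<subseteq> carrier K" using Cons.prems by auto
  have c: "list_prod K (map2 (\<lambda>v e. f v [^]\<^bsub>K\<^esub> e) ws es) \<in> carrier K" for es :: "nat list"
    using w(2) by (intro list_prod_closed assms(1)) (auto dest!: set_zip_leftD)
  have "(\<exists>es. ?P x (w # ws) es) \<longleftrightarrow>
      (\<exists>es. ?P x ws es) \<or> (\<exists>y. (\<exists>es. ?P y ws es) \<and> x = f w \<otimes>\<^bsub>K\<^esub> y)" (is "?L \<longleftrightarrow> ?R")
  proof
    assume ?L
    then obtain es where es: "?P x (w # ws) es" by blast
    then obtain e es' where e: "es = e # es'" by (cases es) auto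
    have "e = 0 \<or> e = 1" using es e by auto
    then show ?R
    proof
      assume "e = 0"
      then have "?P x ws es'" using es e c[of es'] by (simp add: list_prod_def)
      then show ?R by blast
    next
      assume "e = 1"
      then have "?P (list_prod K (map2 (\<lambda>v e. f v [^]\<^bsub>K\<^esub> e) ws es')) ws es' \<and>
          x = f w \<otimes>\<^bsub>K\<^esub> list_prod K (map2 (\<lambda>v e. f v [^]\<^bsub>K\<^esub> e) ws es')"
        using es e w(1) by (simp add: list_prod_def)
      then show ?R by blast
    qed
  next
    assume ?R
    then show ?L
    proof (elim disjE exE conjE)
      fix es :: "nat list"
      assume "length es = length ws" "set es \<subseteq> {0, 1}"
        "x = list_prod K (map2 (\<lambda>v e. f v [^]\<^bsub>K\<^esub> e) ws es)"
      then show ?L using c[of es] by (intro exI[of _ "0 # es"]) (simp add: list_prod_def)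
    next
      fix es :: "nat list" and y
      assume "length es = length ws" "set es \<subseteq> {0, 1}"
        "y = list_prod K (map2 (\<lambda>v e. f v [^]\<^bsub>K\<^esub> e) ws es)" "x = f w \<otimes>\<^bsub>K\<^esub> y"
      then show ?L using w(1) by (intro exI[of _ "1 # es"]) (simp add: list_prod_def)
    qed
  qed
  also have "\<dots> \<longleftrightarrow> (\<exists>vs. subseq vs ws \<and> x = list_prod K (map f vs)) \<or>
      (\<exists>y. (\<exists>vs. subseq vs ws \<and> y = list_prod K (map f vs)) \<and> x = f w \<otimes>\<^bsub>K\<^esub> y)"
    by (simp only: Cons.IH[OF w(2)])
  also have "\<dots> \<longleftrightarrow> (\<exists>vs. subseq vs (w # ws) \<and> x = list_prod K (map f vs))"
  proof -
    have "subseq vs (w # ws) \<longleftrightarrow> subseq vs ws \<or> (\<exists>us. vs = w # us \<and> subseq us ws)" for vs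
      by (cases vs) (auto dest: subseq_Cons')
    then show ?thesis by (auto simp: list_prod_def)
  qed
  finally show ?case .
qed

section \<open>The free group of rank two acting on reduced words\<close>

text \<open>
  The pair \<open>(i, True)\<close> is the letter \<open>i\<close> and \<open>(i, False)\<close> its inverse. The function \<open>push\<close> below is
  left multiplication by a letter in the free group on these letters, if its argument is reduced.
\<close>

definition reduced :: "(int \<times> bool) list \<Rightarrow> bool" where
  "reduced = successively (\<lambda>p q. q \<noteq> (fst p, \<not> snd p))"

fun push :: "int \<times> bool \<Rightarrow> (int \<times> bool) list \<Rightarrow> (int \<times> bool) list" where
  "push p [] = [p]"
| "push p (q # s) = (if q = (fst p, \<not> snd p) then s else p # q # s)"

lemma reduced_push: "reduced s \<Longrightarrow> reduced (push p s)"
  by (cases s) (auto simp: reduced_def successively_Cons)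

text \<open>
  Here the word has to be reduced: if \<open>s\<close> starts with \<open>(i, b)\<close> followed by \<open>(i, \<not> b)\<close>, the inner
  \<open>push\<close> removes the first of them and the outer one the second. Hence the action of \<open>F\<^sub>2\<close> is on
  reduced words.
\<close>

lemma push_push: "reduced s \<Longrightarrow> push (i, b) (push (i, \<not> b) s) = s"
  by (cases s rule: remdups_adj.cases) (auto simp: reduced_def)

definition shift :: "int \<Rightarrow> (int \<times> bool) list \<Rightarrow> (int \<times> bool) list" where
  "shift k = map (\<lambda>(i, b). (i + k, b))"

lemma shift_shift: "shift j (shift k s) = shift (j + k) s"
  by (auto simp: shift_def)

lemma shift_0 [simp]: "shift 0 s = s"
  by (simp add: shift_def)

lemma reduced_shift: "reduced s \<Longrightarrow> reduced (shift k s)"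
  unfolding reduced_def shift_def successively_map
  by (erule successively_mono) (auto simp: prod_eq_iff case_prod_beta)

lemma shift_push: "shift k (push (i, b) s) = push (i + k, b) (shift k s)"
  by (cases s) (auto simp: shift_def)

text \<open>
  The letter \<open>(True, _)\<close> of \<open>F\<^sub>2\<close> plays the role of \<open>x\<close>, and \<open>(False, _)\<close> that of \<open>y\<close>.
\<close>

fun letter_action :: "bool \<times> bool \<Rightarrow> (int \<times> bool) list \<Rightarrow> (int \<times> bool) list" where
  "letter_action (True, b) = shift (if b then 1 else - 1)"
| "letter_action (False, b) = push (0, b)"

definition word_action :: "(bool \<times> bool) list \<Rightarrow> (int \<times> bool) list \<Rightarrow> (int \<times> bool) list" where
  "word_action = foldr letter_action"

lemma word_action_simps [simp]:
  "word_action [] s = s"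
  "word_action (c # u) s = letter_action c (word_action u s)"
  "word_action (u @ v) s = word_action u (word_action v s)"
  by (simp_all add: word_action_def)

lemma reduced_word_action: "reduced s \<Longrightarrow> reduced (word_action u s)"
proof (induction u)
  case (Cons c u)
  then show ?case by (cases c rule: letter_action.cases) (auto simp: reduced_push reduced_shift)
qed simp

abbreviation F2_cong :: "((bool \<times> bool) list \<times> (bool \<times> bool) list) set" where
  "F2_cong \<equiv> pres_cong (UNIV \<times> UNIV) {([(s, b), (s, \<not> b)], []) | s b. s \<in> UNIV}"

definition F2_class :: "(bool \<times> bool) list \<Rightarrow> (bool \<times> bool) list set" where
  "F2_class u = F2_cong `` {u}"

lemma word_action_cong:
  assumes "(u, v) \<in> F2_cong" "reduced s"
  shows "word_action u s = word_action v s"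
  using assms
proof (induction arbitrary: s)
  case (base u v)
  then obtain c b where "u = [(c, b), (c, \<not> b)]" "v = []" by blast
  then show ?case using base by (cases c) (auto simp: shift_shift push_push)
next
  case (sym u v)
  then show ?case by metis
next
  case (trans u v w)
  then show ?case by metis
next
  case (append u u' v v')
  then show ?case by (simp add: reduced_word_action)
qed simp

lemma F2_class_eqD:
  assumes "F2_class u = F2_class v" "reduced s"
  shows "word_action u s = word_action v s"
proof -
  have "(u, v) \<in> F2_cong"
    using assms(1) unfolding F2_class_def
    by (subst (asm) eq_equiv_class_iff[OF pres_cong_equiv]) auto
  then show ?thesis using assms(2) by (rule word_action_cong)
qed

lemma F2_class_append: "F2_class (u @ v) = F2_class u \<otimes>\<^bsub>F\<^sub>2\<^esub> F2_class v"
proof -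
  have "u \<in> lists (UNIV \<times> UNIV)" "v \<in> lists (UNIV \<times> UNIV)" by auto
  from presented_monoid_mult[OF this, of "{([(s, b), (s, \<not> b)], []) | s b. s \<in> UNIV}"]
  show ?thesis unfolding F\<^sub>2_def free_group_def F2_class_def ..
qed

lemma F2_class_Nil: "F2_class [] = \<one>\<^bsub>F\<^sub>2\<^esub>"
  unfolding F\<^sub>2_def free_group_def presented_monoid_one F2_class_def ..
lemma F2_class_closed: "F2_class u \<in> carrier F\<^sub>2"
proof -
  have "u \<in> lists (UNIV \<times> UNIV)" by auto
  then show ?thesis
  unfolding F\<^sub>2_def free_group_def presented_monoid_carrier F2_class_def
      by (intro bexI[of _ u] HOL.refl)
qed

definition inverse_word :: "(bool \<times> bool) list \<Rightarrow> (bool \<times> bool) list" where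
  "inverse_word u = rev (map (\<lambda>(s, b). (s, \<not> b)) u)"

lemma F2_class_inverse: "F2_class (u @ inverse_word u) = \<one>\<^bsub>F\<^sub>2\<^esub>"
proof -
  have "(u @ inverse_word u, []) \<in> F2_cong"
  proof (induction u)
    case Nil
    show ?case by (simp add: inverse_word_def pres_cong.refl)
  next
    case (Cons c u)
    obtain s b where c: "c = (s, b)" by (cases c)
    have "([c] @ (u @ inverse_word u) @ [(s, \<not> b)], [c] @ [] @ [(s, \<not> b)]) \<in> F2_cong"
      by (intro pres_cong.append Cons.IH pres_cong.refl) simp_all
    moreover have "([c] @ [] @ [(s, \<not> b)], []) \<in> F2_cong"
      unfolding c by (rule pres_cong.base) auto
    ultimately show ?case
      unfolding c by (auto simp: inverse_word_def intro: pres_cong.trans)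
  qed
  from equiv_class_eq[OF pres_cong_equiv this] show ?thesis
    unfolding F2_class_Nil[symmetric] F2_class_def .
qed

text \<open>
  The word \<open>x\<^sup>n y x\<^sup>-\<^sup>n\<close> for \<open>z\<^sub>n\<close> or, if \<open>b\<close> is \<open>False\<close>, the word \<open>x\<^sup>n y\<^sup>-\<^sup>1 x\<^sup>-\<^sup>n\<close> for its inverse.
\<close>

definition vertex_letters :: "nat \<Rightarrow> bool \<Rightarrow> (bool \<times> bool) list" where
  "vertex_letters n b = replicate n (True, True) @ [(False, b)] @ replicate n (True, False)"

lemma inverse_vertex_letters: "inverse_word (vertex_letters n b) = vertex_letters n (\<not> b)"
  by (simp add: inverse_word_def vertex_letters_def map_replicate_const)

lemma F2_class_vertex: "F2_class (vertex_letters n b @ vertex_letters n (\<not> b)) = \<one>\<^bsub>F\<^sub>2\<^esub>"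
  using F2_class_inverse[of "vertex_letters n b"] by (simp add: inverse_vertex_letters)

lemma word_action_replicate:
  "word_action (replicate n (True, b)) s = shift (if b then int n else - int n) s"
  by (induction n) (auto simp: shift_shift)

text \<open>
  Conjugation by the shift: \<open>x\<^sup>-\<^sup>n\<close> lowers all indices by \<open>n\<close>, then the letter \<open>0\<close> is pushed, and \<open>x\<^sup>n\<close>
  turns it into the letter \<open>n\<close> while it restores the others.
\<close>

lemma word_action_vertex_letters: "word_action (vertex_letters n b) s = push (int n, b) s"
  by (simp add: vertex_letters_def word_action_replicate shift_push shift_shift)

section \<open>Sequences of edges\<close>

text \<open>
  The reduced word of \<open>z\<^sub>u z\<^sub>v\<^sup>-\<^sup>1 \<cdots>\<close> over the edges \<open>(u, l, v)\<close> of the sequence.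
\<close>

definition trace :: "edge list \<Rightarrow> (int \<times> bool) list" where
  "trace es = foldr (\<lambda>(u, l, v) s. push (int u, True) (push (int v, False) s)) es []"

lemma trace_Cons [simp]:
  "trace [] = []"
  "trace ((u, l, v) # es) = push (int u, True) (push (int v, False) (trace es))"
  by (simp_all add: trace_def)

lemma word_action_trace:
  "word_action (concat (map (\<lambda>(u, l, v). vertex_letters u True @ vertex_letters v False) es)) [] =
    trace es"
  by (induction es) (auto simp: word_action_vertex_letters)

text \<open>
  By induction from the last edge to the first. The factor \<open>z\<^sub>v\<^sup>-\<^sup>1\<close> of a new edge from \<open>u\<close> to \<open>v\<close> cancels
  exactly if the first segment starts in \<open>v\<close>, and then the edge extends this segment. Afterwards
  \<open>z\<^sub>u\<close> does not cancel: the next letter is the inverse of \<open>z\<^sub>t\<close>, where \<open>t\<close> is the end of a walk that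
  starts in \<open>u\<close>, and \<open>u = t\<close> would give a cycle.
\<close>

lemma trace_segments:
  assumes "acyclic (arcs E)" "set es \<subseteq> E"
  obtains segs where
    "\<forall>(s, p, t)\<in>set segs. p \<noteq> [] \<and> set p \<subseteq> E \<and> walk s p t"
    "es = concat (map (\<lambda>(s, p, t). p) segs)"
    "trace es = concat (map (\<lambda>(s, p, t). [(int s, True), (int t, False)]) segs)"
  using assms(2)
proof (induction es arbitrary: thesis)
  case Nil
  show ?case by (rule Nil(1)[of "[]"]) simp_all
next
  case (Cons e es)
  obtain u l v where e: "e = (u, l, v)" by (rule prod_cases3)
  have noloop: "s \<noteq> t" if "p \<noteq> []" "set p \<subseteq> E" "walk s p t" for s p t
    using walk_trancl[of p E s t] that assms(1) by (auto simp: acyclic_def)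
  obtain segs where segs:
    "\<forall>(s, p, t)\<in>set segs. p \<noteq> [] \<and> set p \<subseteq> E \<and> walk s p t"
    "es = concat (map (\<lambda>(s, p, t). p) segs)"
    "trace es = concat (map (\<lambda>(s, p, t). [(int s, True), (int t, False)]) segs)"
    using Cons.IH Cons.prems(2) by auto
  show ?case
  proof (cases "\<exists>p t rest. segs = (v, p, t) # rest")
    case True
    then obtain p t rest where r: "segs = (v, p, t) # rest" by blast
    have p: "e # p \<noteq> []" "set (e # p) \<subseteq> E" "walk u (e # p) t"
      using segs(1) Cons.prems(2) by (auto simp: r e)
    from noloop[OF p] have "u \<noteq> t" .
    then show ?thesis
      using segs p by (intro Cons.prems(1)[of "(u, e # p, t) # rest"]) (auto simp: r e)
  next
    case False
    have p: "[e] \<noteq> []" "set [e] \<subseteq> E" "walk u [e] v"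
      using Cons.prems(2) by (auto simp: e)
    from noloop[OF p] have "u \<noteq> v" .
    moreover have "push (int v, False) (trace es) = (int v, False) # trace es"
      using False segs(3) by (cases segs) auto
    ultimately show ?thesis
      using segs p by (intro Cons.prems(1)[of "(u, [e], v) # segs"]) (auto simp: e)
  qed
qed

text \<open>
  If \<open>u = v\<close>, the right-hand trace is empty, hence there is no segment and \<open>es\<close> is the empty walk.
  Otherwise the trace consists of two letters, which leaves room for one segment only.
\<close>

lemma trace_eq_imp_walk:
  assumes "acyclic (arcs E)" "set es \<subseteq> E" "trace es = trace [(u, l, v)]"
  shows "walk u es v"
proof -
  obtain segs where segs:
    "\<forall>(s, p, t)\<in>set segs. p \<noteq> [] \<and> set p \<subseteq> E \<and> walk s p t"
    "es = concat (map (\<lambda>(s, p, t). p) segs)"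
    "trace es = concat (map (\<lambda>(s, p, t). [(int s, True), (int t, False)]) segs)"
    by (rule trace_segments[OF assms(1,2)])
  show ?thesis
  proof (cases "u = v")
    case True
    then have "segs = []" using segs(3) assms(3) by (cases segs) auto
    then show ?thesis using segs(2) True by simp
  next
    case False
    then have t: "trace es = [(int u, True), (int v, False)]" using assms(3) by simp
    then obtain s p t rest where r: "segs = (s, p, t) # rest" using segs(3) by (cases segs) auto
    have "rest = []" using t segs(3) by (cases rest) (auto simp: r)
    then show ?thesis using segs t by (auto simp: r)
  qed
qed

section \<open>Correctness of the reduction\<close>

text \<open>
  A word for \<open>z\<^sub>u w z\<^sub>v\<^sup>-\<^sup>1\<close>, given words \<open>fw\<close> for the letters of \<open>F\<^sub>2\<close> and words \<open>gw\<close> for the generators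
  of \<open>G\<close>. Both the edges and the right-hand side of the instance have this form.
\<close>

definition link_word :: "(bool \<times> bool \<Rightarrow> gword) \<Rightarrow> (nat \<Rightarrow> gword) \<Rightarrow> nat \<Rightarrow> gword \<Rightarrow> nat \<Rightarrow> gword" where
  "link_word fw gw u w v =
     concat (map fw (vertex_letters u True)) @ concat (map gw w) @
     concat (map fw (vertex_letters v False))"

definition edge_word :: "(bool \<times> bool \<Rightarrow> gword) \<Rightarrow> (nat \<Rightarrow> gword) \<Rightarrow> edge \<Rightarrow> gword" where
  "edge_word fw gw = (\<lambda>(u, l, v). link_word fw gw u (label_word l) v)"

definition agwp_to_ssp ::
  "(bool \<times> bool \<Rightarrow> gword) \<Rightarrow> (nat \<Rightarrow> gword) \<Rightarrow> agwp_instance \<Rightarrow> ssp_instance" where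
  "agwp_to_ssp fw gw \<Gamma> =
     (concat (replicate (length (enc_agwp \<Gamma>)) (map (edge_word fw gw) (ag_edges \<Gamma>))),
      link_word fw gw (ag_source \<Gamma>) (ag_word \<Gamma>) (ag_target \<Gamma>))"

lemma length_edges_le_enc: "length (ag_edges \<Gamma>) \<le> length (enc_agwp \<Gamma>)"
proof -
  have "length es \<le> length (concat (map enc_edge es))" for es
    by (induction es) (auto simp: enc_edge_def)
  from this[of "ag_edges \<Gamma>"] show ?thesis by (simp add: enc_agwp_def)
qed

text \<open>
  Unlike for groups, preservation of the unit does not follow from that of products.
\<close>

definition monoid_hom :: "('a, 'm) monoid_scheme \<Rightarrow> ('b, 'n) monoid_scheme \<Rightarrow> ('a \<Rightarrow> 'b) set" where
  "monoid_hom K L = {h \<in> hom K L. h \<one>\<^bsub>K\<^esub> = \<one>\<^bsub>L\<^esub>}"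

lemma monoid_homD:
  assumes "h \<in> monoid_hom K L"
  shows "h \<in> hom K L" "h \<one>\<^bsub>K\<^esub> = \<one>\<^bsub>L\<^esub>"
    "\<And>x. x \<in> carrier K \<Longrightarrow> h x \<in> carrier L"
    "\<And>x y. x \<in> carrier K \<Longrightarrow> y \<in> carrier K \<Longrightarrow> h (x \<otimes>\<^bsub>K\<^esub> y) = h x \<otimes>\<^bsub>L\<^esub> h y"
  using assms by (auto simp: monoid_hom_def hom_def)

lemma word_val_Nil [simp]: "word_val K xs [] = \<one>\<^bsub>K\<^esub>"
  by (simp add: word_val_def list_prod_def)

lemma list_prod_Nil: "list_prod K [] = \<one>\<^bsub>K\<^esub>"
  by (simp add: list_prod_def)

lemma list_prod_Cons: "list_prod K (a # as) = a \<otimes>\<^bsub>K\<^esub> list_prod K as"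
  by (simp add: list_prod_def)

lemma letters_in_carrier: "set xs \<subseteq> carrier K \<Longrightarrow> w \<in> words xs \<Longrightarrow> (!) xs ` set w \<subseteq> carrier K"
  by (auto simp: words_def subset_iff)

lemma word_val_closed:
  assumes "monoid K" "set xs \<subseteq> carrier K" "w \<in> words xs"
  shows "word_val K xs w \<in> carrier K"
  unfolding word_val_def using letters_in_carrier[OF assms(2,3)]
      by (intro list_prod_closed assms(1)) simp

lemma word_val_append:
  assumes "monoid K" "set xs \<subseteq> carrier K" "v \<in> words xs" "w \<in> words xs"
  shows "word_val K xs (v @ w) = word_val K xs v \<otimes>\<^bsub>K\<^esub> word_val K xs w"
  unfolding word_val_def map_append
  using letters_in_carrier[OF assms(2,3)] letters_in_carrier[OF assms(2,4)]
  by (intro list_prod_append assms(1)) simp_all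

text \<open>
  What \<open>G * F\<^sub>2\<close> and \<open>G \<times> F\<^sub>2\<close> have in common: both factors embed, and each of them is a retract whose
  projection kills the other factor.
\<close>

locale free_rank_two_retract =
  fixes G :: "('a, 'm) monoid_scheme" and K :: "('k, 'n) monoid_scheme"
    and xs :: "'a list" and ys :: "'k list"
    and \<iota>\<^sub>G :: "'a \<Rightarrow> 'k" and \<iota>\<^sub>F :: "(bool \<times> bool) list set \<Rightarrow> 'k"
    and \<pi>\<^sub>G :: "'k \<Rightarrow> 'a" and \<pi>\<^sub>F :: "'k \<Rightarrow> (bool \<times> bool) list set"
    and fw :: "bool \<times> bool \<Rightarrow> gword" and gw :: "nat \<Rightarrow> gword"
  assumes monoids: "monoid G" "monoid K"
    and letters: "set xs \<subseteq> carrier G" "set ys \<subseteq> carrier K"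
    and homs: "\<iota>\<^sub>G \<in> monoid_hom G K" "\<iota>\<^sub>F \<in> monoid_hom F\<^sub>2 K"
      "\<pi>\<^sub>G \<in> monoid_hom K G" "\<pi>\<^sub>F \<in> monoid_hom K F\<^sub>2"
    and retract: "\<And>x. x \<in> carrier G \<Longrightarrow> \<pi>\<^sub>G (\<iota>\<^sub>G x) = x"
      "\<And>x. x \<in> carrier G \<Longrightarrow> \<pi>\<^sub>F (\<iota>\<^sub>G x) = \<one>\<^bsub>F\<^sub>2\<^esub>"
      "\<And>z. z \<in> carrier F\<^sub>2 \<Longrightarrow> \<pi>\<^sub>G (\<iota>\<^sub>F z) = \<one>\<^bsub>G\<^esub>"
      "\<And>z. z \<in> carrier F\<^sub>2 \<Longrightarrow> \<pi>\<^sub>F (\<iota>\<^sub>F z) = z"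
    and fw: "\<And>c. fw c \<in> words ys" "\<And>c. word_val K ys (fw c) = \<iota>\<^sub>F (F2_class [c])"
    and gw: "\<And>i. i < length xs \<Longrightarrow> gw i \<in> words ys"
      "\<And>i. i < length xs \<Longrightarrow> word_val K ys (gw i) = \<iota>\<^sub>G (xs ! i)"
begin

sublocale G: monoid G by (rule monoids)
sublocale K: monoid K by (rule monoids)
sublocale F2: group F\<^sub>2 unfolding F\<^sub>2_def by (rule free_group_group)

lemmas val_closed = word_val_closed[OF monoids(2) letters(2)]
lemmas val_append = word_val_append[OF monoids(2) letters(2)]
lemmas valG_closed = word_val_closed[OF monoids(1) letters(1)]
lemmas valG_append = word_val_append[OF monoids(1) letters(1)]

lemma words_append [simp]: "u @ v \<in> words zs \<longleftrightarrow> u \<in> words zs \<and> v \<in> words zs"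
  by (simp add: words_def)

lemma fw_words: "concat (map fw u) \<in> words ys"
  using fw(1) by (induction u) (auto simp: words_def)

lemma gw_words: "w \<in> words xs \<Longrightarrow> concat (map gw w) \<in> words ys"
  using gw(1) by (induction w) (auto simp: words_def)

lemma link_word_words: "w \<in> words xs \<Longrightarrow> link_word fw gw u w v \<in> words ys"
  by (simp add: link_word_def fw_words gw_words)

lemma val_fw: "word_val K ys (concat (map fw u)) = \<iota>\<^sub>F (F2_class u)"
proof (induction u)
  case Nil
  show ?case by (simp add: F2_class_Nil monoid_homD(2)[OF homs(2)])
next
  case (Cons c u)
  have "word_val K ys (concat (map fw (c # u))) =
      word_val K ys (fw c) \<otimes>\<^bsub>K\<^esub> word_val K ys (concat (map fw u))"
    using val_append[OF fw(1) fw_words] by simp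
  also have "\<dots> = \<iota>\<^sub>F (F2_class [c]) \<otimes>\<^bsub>K\<^esub> \<iota>\<^sub>F (F2_class u)"
    by (simp only: fw(2) Cons.IH)
  also have "\<dots> = \<iota>\<^sub>F (F2_class [c] \<otimes>\<^bsub>F\<^sub>2\<^esub> F2_class u)"
    by (rule monoid_homD(4)[OF homs(2) F2_class_closed F2_class_closed, symmetric])
  also have "F2_class [c] \<otimes>\<^bsub>F\<^sub>2\<^esub> F2_class u = F2_class (c # u)"
    using F2_class_append[of "[c]" u] by simp
  finally show ?case .
qed

lemma val_gw: "w \<in> words xs \<Longrightarrow> word_val K ys (concat (map gw w)) = \<iota>\<^sub>G (word_val G xs w)"
proof (induction w)
  case Nil
  show ?case by (simp add: monoid_homD(2)[OF homs(1)])
next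
  case (Cons i w)
  then have i: "i < length xs" "w \<in> words xs" "xs ! i \<in> carrier G"
    using letters(1) by (auto simp: words_def)
  have "word_val K ys (concat (map gw (i # w))) =
      word_val K ys (gw i) \<otimes>\<^bsub>K\<^esub> word_val K ys (concat (map gw w))"
    using val_append[OF gw(1)[OF i(1)] gw_words[OF i(2)]] by simp
  also have "\<dots> = \<iota>\<^sub>G (xs ! i) \<otimes>\<^bsub>K\<^esub> \<iota>\<^sub>G (word_val G xs w)"
    by (simp only: gw(2)[OF i(1)] Cons.IH[OF i(2)])
  also have "\<dots> = \<iota>\<^sub>G (xs ! i \<otimes>\<^bsub>G\<^esub> word_val G xs w)"
    by (rule monoid_homD(4)[OF homs(1) i(3) valG_closed[OF i(2)], symmetric])
  also have "xs ! i \<otimes>\<^bsub>G\<^esub> word_val G xs w = word_val G xs (i # w)"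
    by (simp add: word_val_def list_prod_Cons)
  finally show ?case .
qed

abbreviation vertex :: "nat \<Rightarrow> bool \<Rightarrow> 'k" where
  "vertex n b \<equiv> \<iota>\<^sub>F (F2_class (vertex_letters n b))"

lemma vertex_closed: "vertex n b \<in> carrier K"
  by (rule monoid_homD(3)[OF homs(2) F2_class_closed])

lemma vertex_cancel: "vertex n b \<otimes>\<^bsub>K\<^esub> vertex n (\<not> b) = \<one>\<^bsub>K\<^esub>"
  using F2_class_vertex[of n b]
  by (simp add: F2_class_append F2_class_closed monoid_homD(2)[OF homs(2)]
      flip: monoid_homD(4)[OF homs(2)])

lemma val_link_word:
  assumes "w \<in> words xs"
  shows "word_val K ys (link_word fw gw u w v) =
    vertex u True \<otimes>\<^bsub>K\<^esub> \<iota>\<^sub>G (word_val G xs w) \<otimes>\<^bsub>K\<^esub> vertex v False"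
  using assms monoid_homD(3)[OF homs(1) valG_closed[OF assms]]
  by (simp add: link_word_def val_append fw_words gw_words val_fw val_gw vertex_closed K.m_assoc)

lemma \<pi>\<^sub>G_link_word:
  assumes "w \<in> words xs"
  shows "\<pi>\<^sub>G (word_val K ys (link_word fw gw u w v)) = word_val G xs w"
  using assms monoid_homD(3)[OF homs(1) valG_closed[OF assms]]
  by (simp add: val_link_word vertex_closed monoid_homD(4)[OF homs(3)] retract
      F2_class_closed valG_closed)

lemma \<pi>\<^sub>F_link_word:
  assumes "w \<in> words xs"
  shows "\<pi>\<^sub>F (word_val K ys (link_word fw gw u w v)) =
    F2_class (vertex_letters u True @ vertex_letters v False)"
  using assms monoid_homD(3)[OF homs(1) valG_closed[OF assms]]
  by (simp add: val_link_word vertex_closed monoid_homD(4)[OF homs(4)] retract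
      F2_class_closed valG_closed F2_class_append)

lemma walk_word_words: "\<forall>e\<in>set es. label_word (fst (snd e)) \<in> words xs \<Longrightarrow> walk_word es \<in> words xs"
  by (induction es) (auto simp: words_def)

definition edges_prod :: "edge list \<Rightarrow> 'k" where
  "edges_prod es = list_prod K (map (word_val K ys) (map (edge_word fw gw) es))"

lemma edges_prod_closed:
  "\<forall>e\<in>set es. label_word (fst (snd e)) \<in> words xs \<Longrightarrow> edges_prod es \<in> carrier K"
  unfolding edges_prod_def
  by (intro list_prod_closed monoids) (auto simp: edge_word_def intro!: val_closed link_word_words)

lemma edges_prod_Cons:
  "edges_prod ((u, l, v) # es) = word_val K ys (link_word fw gw u (label_word l) v)
      \<otimes>\<^bsub>K\<^esub> edges_prod es"
  by (simp add: edges_prod_def edge_word_def list_prod_Cons)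

lemma \<pi>\<^sub>G_edges_prod:
  "\<forall>e\<in>set es. label_word (fst (snd e)) \<in> words xs \<Longrightarrow>
    \<pi>\<^sub>G (edges_prod es) = word_val G xs (walk_word es)"
proof (induction es)
  case Nil
  show ?case by (simp add: edges_prod_def list_prod_Nil monoid_homD(2)[OF homs(3)])
next
  case (Cons e es)
  obtain u l v where e: "e = (u, l, v)" by (rule prod_cases3)
  have l: "label_word l \<in> words xs" using Cons.prems e by simp
  have es: "edges_prod es \<in> carrier K" "walk_word es \<in> words xs"
    using Cons.prems by (auto intro!: edges_prod_closed walk_word_words)
  show ?case
    using Cons l es unfolding e
    by (simp add: edges_prod_Cons monoid_homD(4)[OF homs(3)] val_closed link_word_words
        \<pi>\<^sub>G_link_word valG_append)
qed

lemma \<pi>\<^sub>F_edges_prod: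
  "\<forall>e\<in>set es. label_word (fst (snd e)) \<in> words xs \<Longrightarrow>
    \<pi>\<^sub>F (edges_prod es) =
      F2_class (concat (map (\<lambda>(u, l, v). vertex_letters u True @ vertex_letters v False) es))"
proof (induction es)
  case Nil
  show ?case by (simp add: edges_prod_def list_prod_Nil monoid_homD(2)[OF homs(4)] F2_class_Nil)
next
  case (Cons e es)
  obtain u l v where e: "e = (u, l, v)" by (rule prod_cases3)
  have l: "label_word l \<in> words xs" using Cons.prems e by simp
  have es: "edges_prod es \<in> carrier K"
    using Cons.prems by (auto intro!: edges_prod_closed)
  show ?case
    using Cons l es unfolding e
    by (simp add: edges_prod_Cons monoid_homD(4)[OF homs(4)] val_closed link_word_words
        \<pi>\<^sub>F_link_word F2_class_append F2_class_closed F2.m_assoc)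
qed

text \<open>
  The product telescopes, because \<open>z\<^sub>b\<^sup>-\<^sup>1 z\<^sub>b\<close> cancels at every inner vertex \<open>b\<close>.
\<close>

lemma edges_prod_walk:
  assumes "walk u es v" "\<forall>e\<in>set es. label_word (fst (snd e)) \<in> words xs"
  shows "edges_prod es =
    vertex u True \<otimes>\<^bsub>K\<^esub> \<iota>\<^sub>G (word_val G xs (walk_word es)) \<otimes>\<^bsub>K\<^esub> vertex v False"
  using assms
proof (induction es arbitrary: u)
  case Nil
  then show ?case
    using vertex_cancel[of v True]
    by (simp add: edges_prod_def list_prod_Nil monoid_homD(2)[OF homs(1)] vertex_closed)
next
  case (Cons e es)
  obtain l b where e: "e = (u, l, b)" using Cons.prems(1) by (cases e) auto
  have l: "label_word l \<in> words xs" using Cons.prems e by simp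
  have es: "walk_word es \<in> words xs"
    using Cons.prems by (auto intro!: walk_word_words)
  let ?p = "\<iota>\<^sub>G (word_val G xs (label_word l))" and ?q = "\<iota>\<^sub>G (word_val G xs (walk_word es))"
  have pq: "?p \<in> carrier K" "?q \<in> carrier K"
    using l es by (auto intro!: monoid_homD(3)[OF homs(1)] valG_closed)
  have "edges_prod es = vertex b True \<otimes>\<^bsub>K\<^esub> ?q \<otimes>\<^bsub>K\<^esub> vertex v False"
    using Cons e by simp
  then have "edges_prod (e # es) = (vertex u True \<otimes>\<^bsub>K\<^esub> ?p \<otimes>\<^bsub>K\<^esub> vertex b False) \<otimes>\<^bsub>K\<^esub>
      (vertex b True \<otimes>\<^bsub>K\<^esub> ?q \<otimes>\<^bsub>K\<^esub> vertex v False)"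
    using l by (simp add: e edges_prod_Cons val_link_word)
  also have "\<dots> = vertex u True \<otimes>\<^bsub>K\<^esub> ?p \<otimes>\<^bsub>K\<^esub> (vertex b False \<otimes>\<^bsub>K\<^esub> vertex b True)
      \<otimes>\<^bsub>K\<^esub> ?q \<otimes>\<^bsub>K\<^esub> vertex v False"
    using pq by (simp add: K.m_assoc vertex_closed)
  also have "\<dots> = vertex u True \<otimes>\<^bsub>K\<^esub> (?p \<otimes>\<^bsub>K\<^esub> ?q) \<otimes>\<^bsub>K\<^esub> vertex v False"
    using pq vertex_cancel[of b False] by (simp add: K.m_assoc vertex_closed)
  also have "?p \<otimes>\<^bsub>K\<^esub> ?q = \<iota>\<^sub>G (word_val G xs (walk_word (e # es)))"
    using l es by (simp add: e valG_append monoid_homD(4)[OF homs(1)] valG_closed)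
  finally show ?case .
qed

text \<open>
  A solution of the subset sum instance is a sequence of edges. Its image in \<open>F\<^sub>2\<close> forces it to be a walk
  from source to target, and its image in \<open>G\<close> gives the value of the label.
\<close>

lemma agwp_to_ssp_correct:
  assumes "\<Gamma> \<in> agwp_instances xs"
  shows "agwp_to_ssp fw gw \<Gamma> \<in> instances (SSP K ys)"
    and "\<Gamma> \<in> positives (AGWP G xs) \<longleftrightarrow> agwp_to_ssp fw gw \<Gamma> \<in> positives (SSP K ys)"
proof -
  define E where "E = ag_edges \<Gamma>"
  define \<alpha> where "\<alpha> = ag_source \<Gamma>"
  define \<omega> where "\<omega> = ag_target \<Gamma>"
  define w where "w = ag_word \<Gamma>"
  define ws where "ws = map (edge_word fw gw) (concat (replicate (length (enc_agwp \<Gamma>)) E))"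
  have f: "agwp_to_ssp fw gw \<Gamma> = (ws, link_word fw gw \<alpha> w \<omega>)"
    by (simp add: agwp_to_ssp_def ws_def E_def \<alpha>_def \<omega>_def w_def map_concat)
  have acyc: "acyclic (arcs (set E))" and w: "w \<in> words xs"
    and lab: "\<forall>e\<in>set E. label_word (fst (snd e)) \<in> words xs"
    using assms by (auto simp: agwp_instances_def E_def arcs_def w_def)
  have ws: "ws \<in> lists (words ys)"
    using lab by (fastforce simp: ws_def edge_word_def intro!: link_word_words)
  have t: "link_word fw gw \<alpha> w \<omega> \<in> words ys" by (rule link_word_words[OF w])
  show "agwp_to_ssp fw gw \<Gamma> \<in> instances (SSP K ys)"
    using ws t by (simp add: f SSP_def)
  have sub: "(\<exists>vs. subseq vs ws \<and> x = list_prod K (map (word_val K ys) vs)) \<longleftrightarrow>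
      (\<exists>es. subseq es (concat (replicate (length (enc_agwp \<Gamma>)) E)) \<and> x = edges_prod es)" for x
    unfolding ws_def edges_prod_def subseq_conv_nths by (auto simp: nths_map)
  have "agwp_to_ssp fw gw \<Gamma> \<in> positives (SSP K ys) \<longleftrightarrow>
      (\<exists>vs. subseq vs ws \<and> word_val K ys (link_word fw gw \<alpha> w \<omega>) = list_prod K (map (word_val K
          ys) vs))"
    using ws t val_closed
    by (subst subset_product_iff_subseq[OF monoids(2), symmetric]) (auto simp: f SSP_def)
  also have "\<dots> \<longleftrightarrow> (\<exists>es. subseq es (concat (replicate (length (enc_agwp \<Gamma>)) E)) \<and>
      word_val K ys (link_word fw gw \<alpha> w \<omega>) = edges_prod es)"
    by (rule sub)
  also have "\<dots> \<longleftrightarrow> (\<exists>es. set es \<subseteq> set E \<and> walk \<alpha> es \<omega> \<and> word_val G xs (walk_word es) =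
      word_val G xs w)"
  proof (intro iffI; elim exE conjE)
    fix es assume s: "subseq es (concat (replicate (length (enc_agwp \<Gamma>)) E))"
      and eq: "word_val K ys (link_word fw gw \<alpha> w \<omega>) = edges_prod es"
    obtain N where "es = nths (concat (replicate (length (enc_agwp \<Gamma>)) E)) N"
      using s by (auto simp: subseq_conv_nths)
    then have "set es \<subseteq> set (concat (replicate (length (enc_agwp \<Gamma>)) E))"
      by (simp only: set_nths_subset)
    also have "\<dots> \<subseteq> set E" by auto
    finally have es: "set es \<subseteq> set E" .
    then have labs: "\<forall>e\<in>set es. label_word (fst (snd e)) \<in> words xs" using lab es by blast
    have "word_val G xs (walk_word es) = word_val G xs w"
      using arg_cong[OF eq, of \<pi>\<^sub>G] by (simp add: \<pi>\<^sub>G_link_word[OF w] \<pi>\<^sub>G_edges_prod[OF labs])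
    moreover have "walk \<alpha> es \<omega>"
    proof (rule trace_eq_imp_walk[OF acyc es])
      have "word_action (vertex_letters \<alpha> True @ vertex_letters \<omega> False) [] = trace es"
        using arg_cong[OF eq, of \<pi>\<^sub>F]
        unfolding \<pi>\<^sub>F_link_word[OF w] \<pi>\<^sub>F_edges_prod[OF labs] word_action_trace[symmetric]
        by (rule F2_class_eqD) (simp add: reduced_def)
      \<comment> \<open>the label does not enter the trace, so any would do\<close>
      then show "trace es = trace [(\<alpha>, None, \<omega>)]" by (simp add: word_action_vertex_letters)
    qed
    ultimately show "\<exists>es. set es \<subseteq> set E \<and> walk \<alpha> es \<omega> \<and> word_val G xs (walk_word es) =
        word_val G xs w"
      using es by blast
  next
    fix es assume es: "set es \<subseteq> set E" "walk \<alpha> es \<omega>" "word_val G xs (walk_word es) =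
        word_val G xs w"
    have labs: "\<forall>e\<in>set es. label_word (fst (snd e)) \<in> words xs" using lab es by blast
    have "length es \<le> length (enc_agwp \<Gamma>)"
      using walk_length_le[OF acyc es(1,2)] length_edges_le_enc[of \<Gamma>] by (simp add: E_def)
    from subseq_concat_replicate[OF es(1) this] edges_prod_walk[OF es(2) labs]
    show "\<exists>es. subseq es (concat (replicate (length (enc_agwp \<Gamma>)) E)) \<and>
        word_val K ys (link_word fw gw \<alpha> w \<omega>) = edges_prod es"
      using es(3) val_link_word[OF w] by auto
  qed
  also have "\<dots> \<longleftrightarrow> \<Gamma> \<in> positives (AGWP G xs)"
    using assms by (auto simp: AGWP_def labelled_path_iff_walk E_def \<alpha>_def \<omega>_def w_def)
  finally show "\<Gamma> \<in> positives (AGWP G xs) \<longleftrightarrow> agwp_to_ssp fw gw \<Gamma> \<in> positives (SSP K ys)" ..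
qed

end

section \<open>Homomorphisms out of presented monoids\<close>

text \<open>
  The choice of a word from the class is immaterial if \<open>h\<close> respects the relators (\<open>list_prod_pres_cong\<close>).
\<close>

definition presented_lift :: "('b, 'm) monoid_scheme \<Rightarrow> ('a \<Rightarrow> 'b) \<Rightarrow> 'a list set \<Rightarrow> 'b" where
  "presented_lift L h P = list_prod L (map h (SOME u. u \<in> P))"

lemma list_prod_pres_cong:
  assumes "monoid L" "h ` A \<subseteq> carrier L"
    and rel: "\<And>u v. (u, v) \<in> R \<Longrightarrow> u \<in> lists A \<Longrightarrow> v \<in> lists A \<Longrightarrow>
      list_prod L (map h u) = list_prod L (map h v)"
    and "(u, v) \<in> pres_cong A R"
  shows "u \<in> lists A \<and> v \<in> lists A \<and> list_prod L (map h u) = list_prod L (map h v)"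
  using assms(4)
proof induction
  case (base u v)
  then show ?case using rel by simp
next
  case (append u u' v v')
  have c: "set (map h w) \<subseteq> carrier L" if "w \<in> lists A" for w
    using that assms(2) by auto
  from append.IH show ?case
    by (simp add: list_prod_append[OF assms(1) c c] del: set_map in_lists_conv_set)
qed simp_all

lemma presented_lift_class:
  assumes "monoid L" "h ` A \<subseteq> carrier L"
    and rel: "\<And>u v. (u, v) \<in> R \<Longrightarrow> u \<in> lists A \<Longrightarrow> v \<in> lists A \<Longrightarrow>
      list_prod L (map h u) = list_prod L (map h v)"
    and u: "u \<in> lists A"
  shows "presented_lift L h (pres_cong A R `` {u}) = list_prod L (map h u)"
proof -
  have "u \<in> pres_cong A R `` {u}" using pres_cong.refl[OF u] by simp
  then have "(SOME v. v \<in> pres_cong A R `` {u}) \<in> pres_cong A R `` {u}" by (rule someI)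
  then have "(u, SOME v. v \<in> pres_cong A R `` {u}) \<in> pres_cong A R" by simp
  from list_prod_pres_cong[OF assms(1,2) rel this] show ?thesis
    by (simp add: presented_lift_def)
qed

lemma presented_lift_hom:
  assumes "monoid L" "h ` A \<subseteq> carrier L"
    and rel: "\<And>u v. (u, v) \<in> R \<Longrightarrow> u \<in> lists A \<Longrightarrow> v \<in> lists A \<Longrightarrow>
      list_prod L (map h u) = list_prod L (map h v)"
  shows "presented_lift L h \<in> monoid_hom (presented_monoid A R) L"
proof -
  have lift: "presented_lift L h (pres_cong A R `` {w}) = list_prod L (map h w)" if "w \<in> lists A"
      for w
    by (rule presented_lift_class[OF assms(1,2) _ that]) (rule rel)
  have c: "set (map h w) \<subseteq> carrier L" if "w \<in> lists A" for w
    using that assms(2) by auto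
  have "presented_lift L h \<in> hom (presented_monoid A R) L"
  proof (rule homI)
    fix x assume "x \<in> carrier (presented_monoid A R)"
    then obtain u where u: "u \<in> lists A" "x = pres_cong A R `` {u}"
      unfolding presented_monoid_carrier by blast
    show "presented_lift L h x \<in> carrier L"
      unfolding u(2) lift[OF u(1)] by (rule list_prod_closed[OF assms(1) c[OF u(1)]])
    fix y assume "y \<in> carrier (presented_monoid A R)"
    then obtain v where v: "v \<in> lists A" "y = pres_cong A R `` {v}"
      unfolding presented_monoid_carrier by blast
    have uv: "u @ v \<in> lists A" using u(1) v(1) by simp
    show "presented_lift L h (x \<otimes>\<^bsub>presented_monoid A R\<^esub> y) =
        presented_lift L h x \<otimes>\<^bsub>L\<^esub> presented_lift L h y"
      unfolding u(2) v(2) presented_monoid_mult[OF u(1) v(1)] lift[OF u(1)] lift[OF v(1)] lift[OF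
          uv]
        map_append by (rule list_prod_append[OF assms(1) c[OF u(1)] c[OF v(1)]])
  qed
  moreover have "presented_lift L h \<one>\<^bsub>presented_monoid A R\<^esub> = \<one>\<^bsub>L\<^esub>"
    unfolding presented_monoid_one using lift[OF lists.Nil] by (simp add: list_prod_Nil)
  ultimately show ?thesis by (simp add: monoid_hom_def)
qed

text \<open>
  The existence part of the universal property of the free product.
\<close>

lemma free_product_lift:
  assumes "monoid G" "monoid H" "monoid L" "f \<in> monoid_hom G L" "g \<in> monoid_hom H L"
  obtains \<pi> where "\<pi> \<in> monoid_hom (free_product G H) L"
    "\<And>x. x \<in> carrier G \<Longrightarrow> \<pi> (fp_incl G H (Inl x)) = f x"
    "\<And>y. y \<in> carrier H \<Longrightarrow> \<pi> (fp_incl G H (Inr y)) = g y"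
proof -
  interpret L: monoid L by fact
  define h where "h = case_sum f g"
  let ?A = "carrier G <+> carrier H"
  note f = monoid_homD[OF assms(4)] and g = monoid_homD[OF assms(5)]
  have h: "h ` ?A \<subseteq> carrier L"
    using f(3) g(3) by (auto simp: h_def)
  have rel: "list_prod L (map h u) = list_prod L (map h v)"
    if "(u, v) \<in> fp_relators G H" "u \<in> lists ?A" "v \<in> lists ?A" for u v
    using that(1) f(2-4) g(2-4) monoid.m_closed[OF assms(1)] monoid.m_closed[OF assms(2)]
    unfolding fp_relators_def by (auto simp: h_def list_prod_def)
  have lift: "presented_lift L h (pres_cong ?A (fp_relators G H) `` {w}) = list_prod L (map h w)"
    if "w \<in> lists ?A" for w
    by (rule presented_lift_class[OF assms(3) h _ that]) (rule rel)
  have l: "presented_lift L h (fp_incl G H a) = h a" if "a \<in> ?A" for a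
  proof -
    have "h a \<in> carrier L" using that h by auto
    then show ?thesis
      unfolding fp_incl_def using that lift[of "[a]"] by (simp add: list_prod_def)
  qed
  show ?thesis
  proof (rule that)
    show "presented_lift L h \<in> monoid_hom (free_product G H) L"
      unfolding free_product_def by (rule presented_lift_hom[OF assms(3) h]) (rule rel)
    show "presented_lift L h (fp_incl G H (Inl x)) = f x" if "x \<in> carrier G" for x
      using l[of "Inl x"] that by (simp add: h_def InlI)
    show "presented_lift L h (fp_incl G H (Inr y)) = g y" if "y \<in> carrier H" for y
      using l[of "Inr y"] that by (simp add: h_def InrI)
  qed
qed

lemma monoid_hom_trivial: "monoid L \<Longrightarrow> (\<lambda>_. \<one>\<^bsub>L\<^esub>) \<in> monoid_hom K L"
  using monoid.l_one[OF _ monoid.one_closed]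
      by (auto simp: monoid_hom_def intro!: homI monoid.one_closed)

lemma monoid_hom_id: "(\<lambda>x. x) \<in> monoid_hom K K"
  by (auto simp: monoid_hom_def intro!: homI)

lemma F2_monoid: "monoid F\<^sub>2"
  unfolding F\<^sub>2_def by (rule group.is_monoid[OF free_group_group])

lemma free_rank_two_retract_words:
  assumes "monoid G" "monoid K" "generating_family G xs" "generating_family K ys"
    and homs: "\<iota>\<^sub>G \<in> monoid_hom G K" "\<iota>\<^sub>F \<in> monoid_hom F\<^sub>2 K"
      "\<pi>\<^sub>G \<in> monoid_hom K G" "\<pi>\<^sub>F \<in> monoid_hom K F\<^sub>2"
    and "\<And>x. x \<in> carrier G \<Longrightarrow> \<pi>\<^sub>G (\<iota>\<^sub>G x) = x"
      "\<And>x. x \<in> carrier G \<Longrightarrow> \<pi>\<^sub>F (\<iota>\<^sub>G x) = \<one>\<^bsub>F\<^sub>2\<^esub>"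
      "\<And>z. z \<in> carrier F\<^sub>2 \<Longrightarrow> \<pi>\<^sub>G (\<iota>\<^sub>F z) = \<one>\<^bsub>G\<^esub>"
      "\<And>z. z \<in> carrier F\<^sub>2 \<Longrightarrow> \<pi>\<^sub>F (\<iota>\<^sub>F z) = z"
  obtains fw gw where "free_rank_two_retract G K xs ys \<iota>\<^sub>G \<iota>\<^sub>F \<pi>\<^sub>G \<pi>\<^sub>F fw gw"
proof -
  have ex: "\<exists>w. w \<in> words ys \<and> word_val K ys w = x" if "x \<in> carrier K" for x
    using assms(4) that unfolding generating_family_def by blast
  have xs: "set xs \<subseteq> carrier G" "set ys \<subseteq> carrier K"
    using assms(3,4) unfolding generating_family_def by blast+
  have "\<exists>w. w \<in> words ys \<and> word_val K ys w = \<iota>\<^sub>F (F2_class [c])" for c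
    by (rule ex[OF monoid_homD(3)[OF homs(2) F2_class_closed]])
  then obtain fw where "\<And>c. fw c \<in> words ys" "\<And>c. word_val K ys (fw c) = \<iota>\<^sub>F (F2_class [c])"
    by metis
  moreover have "\<exists>w. w \<in> words ys \<and> word_val K ys w = \<iota>\<^sub>G (xs ! i)" if "i < length xs" for i
    using that xs(1) by (intro ex monoid_homD(3)[OF homs(1)]) auto
  then obtain gw where "\<And>i. i < length xs \<Longrightarrow> gw i \<in> words ys"
      "\<And>i. i < length xs \<Longrightarrow> word_val K ys (gw i) = \<iota>\<^sub>G (xs ! i)"
    by metis
  ultimately have "free_rank_two_retract G K xs ys \<iota>\<^sub>G \<iota>\<^sub>F \<pi>\<^sub>G \<pi>\<^sub>F fw gw"
    using assms(1,2) xs assms(5-) by (intro free_rank_two_retract.intro)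
  then show ?thesis by (rule that)
qed

text \<open>
  The projections come from the universal property: identity on one factor, trivial on the other.
\<close>

lemma free_product_retract:
  assumes "monoid G" "generating_family G xs" "generating_family (free_product G F\<^sub>2) ys"
  obtains \<iota>\<^sub>G \<iota>\<^sub>F \<pi>\<^sub>G \<pi>\<^sub>F fw gw
  where "free_rank_two_retract G (free_product G F\<^sub>2) xs ys \<iota>\<^sub>G \<iota>\<^sub>F \<pi>\<^sub>G \<pi>\<^sub>F fw gw"
proof -
  obtain \<pi>\<^sub>G where pG: "\<pi>\<^sub>G \<in> monoid_hom (free_product G F\<^sub>2) G"
    "\<And>x. x \<in> carrier G \<Longrightarrow> \<pi>\<^sub>G (fp_incl G F\<^sub>2 (Inl x)) = x"
    "\<And>y. y \<in> carrier F\<^sub>2 \<Longrightarrow> \<pi>\<^sub>G (fp_incl G F\<^sub>2 (Inr y)) = \<one>\<^bsub>G\<^esub>"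
    by (rule free_product_lift[OF assms(1) F2_monoid assms(1) monoid_hom_id
        monoid_hom_trivial[OF assms(1)]]) blast
  obtain \<pi>\<^sub>F where pF: "\<pi>\<^sub>F \<in> monoid_hom (free_product G F\<^sub>2) F\<^sub>2"
    "\<And>x. x \<in> carrier G \<Longrightarrow> \<pi>\<^sub>F (fp_incl G F\<^sub>2 (Inl x)) = \<one>\<^bsub>F\<^sub>2\<^esub>"
    "\<And>y. y \<in> carrier F\<^sub>2 \<Longrightarrow> \<pi>\<^sub>F (fp_incl G F\<^sub>2 (Inr y)) = y"
    by (rule free_product_lift[OF assms(1) F2_monoid F2_monoid
        monoid_hom_trivial[OF F2_monoid] monoid_hom_id]) blast
  have "(\<lambda>x. fp_incl G F\<^sub>2 (Inl x)) \<in> monoid_hom G (free_product G F\<^sub>2)"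
    "(\<lambda>y. fp_incl G F\<^sub>2 (Inr y)) \<in> monoid_hom F\<^sub>2 (free_product G F\<^sub>2)"
    using fp_incl_hom[OF assms(1) F2_monoid] by (simp_all add: monoid_hom_def)
  from assms(1) free_product_monoid assms(2,3) this pG(1) pF(1) pG(2) pF(2) pG(3) pF(3)
  show ?thesis by (rule free_rank_two_retract_words) (assumption+, rule that)
qed

lemma direct_product_retract:
  assumes "monoid G" "generating_family G xs" "generating_family (G \<times>\<times> F\<^sub>2) ys"
  obtains \<iota>\<^sub>G \<iota>\<^sub>F \<pi>\<^sub>G \<pi>\<^sub>F fw gw
  where "free_rank_two_retract G (G \<times>\<times> F\<^sub>2) xs ys \<iota>\<^sub>G \<iota>\<^sub>F \<pi>\<^sub>G \<pi>\<^sub>F fw gw"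
proof -
  interpret G: monoid G by fact
  interpret F: monoid F\<^sub>2 by (rule F2_monoid)
  have "(\<lambda>x. (x, \<one>\<^bsub>F\<^sub>2\<^esub>)) \<in> monoid_hom G (G \<times>\<times> F\<^sub>2)"
    "(\<lambda>y. (\<one>\<^bsub>G\<^esub>, y)) \<in> monoid_hom F\<^sub>2 (G \<times>\<times> F\<^sub>2)"
    "fst \<in> monoid_hom (G \<times>\<times> F\<^sub>2) G" "snd \<in> monoid_hom (G \<times>\<times> F\<^sub>2) F\<^sub>2"
    by (auto simp: monoid_hom_def intro!: homI)
  from assms(1) DirProd_monoid[OF assms(1) F2_monoid] assms(2,3) this
  show ?thesis by (rule free_rank_two_retract_words) (simp_all, rule that)
qed

section \<open>Turing machines with an arbitrary finite control\<close>

text \<open>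
  A step of a Turing machine whose states are the elements of an arbitrary type. It performs the same
  actions as a step of a machine with numbered states; \<open>h\<close> is the halting state.
\<close>

definition control_step ::
  "('q \<Rightarrow> nat list \<Rightarrow> 'q \<times> (nat \<times> move) list) \<Rightarrow> 'q \<Rightarrow> 'q \<times> tape list \<Rightarrow> 'q \<times> tape list" where
  "control_step \<delta> h = (\<lambda>(q, ts).
     if q = h then (q, ts)
     else case \<delta> q (map (\<lambda>t. t 0) ts) of (q', acts) \<Rightarrow> (q', map2 act acts ts))"

text \<open>
  The states are numbered by their positions in a list that starts with the initial state and ends
  with the halting state. The condition \<open>state\<close> speaks of arbitrary symbols, so that staying among the
  states does not depend on the contents of the tapes.
\<close>

lemma finite_control_tm:
  assumes Q: "finite Q" "q\<^sub>0 \<in> Q" "h \<notin> Q" and k: "k \<ge> 1" and s: "s \<ge> 1"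
    and state: "\<And>q rs. q \<in> Q \<Longrightarrow> fst (\<delta> q rs) \<in> insert h Q"
    and acts: "\<And>q rs. q \<in> Q \<Longrightarrow> length rs = k \<Longrightarrow> set rs \<subseteq> {..<s} \<Longrightarrow>
      length (snd (\<delta> q rs)) = k \<and> fst ` set (snd (\<delta> q rs)) \<subseteq> {..<s}"
  obtains M where "well_formed_tm M" "tm_tapes M = k" "tm_symbols M = s"
    "\<And>n ts ts'. (control_step \<delta> h ^^ n) (q\<^sub>0, ts) = (h, ts') \<Longrightarrow>
      (tm_step M ^^ n) (0, ts) = (tm_states M, ts')"
proof -
  have "finite (Q - {q\<^sub>0})" using Q(1) by simp
  then obtain qs where qs: "set qs = Q - {q\<^sub>0}" "distinct qs"
    by (meson finite_distinct_list)
  define L where "L = q\<^sub>0 # qs @ [h]"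
  have L: "distinct L" "set L = insert h Q" using qs Q(2,3) by (auto simp: L_def)
  define e where "e = inv_into {..<length L} ((!) L)"
  have inj: "inj_on ((!) L) {..<length L}" using L(1) by (simp add: inj_on_nth)
  have e_nth: "e (L ! i) = i" if "i < length L" for i
    unfolding e_def by (rule inv_into_f_f[OF inj]) (use that in simp)
  have nth_e: "L ! e q = q" "e q < length L" if "q \<in> insert h Q" for q
    using that L(2) e_nth by (metis in_set_conv_nth)+
  have e0: "e q\<^sub>0 = 0" using e_nth[of 0] by (simp add: L_def)
  have eh: "e h = length L - 1" using e_nth[of "length L - 1"] by (simp add: L_def)
  have lt: "e q < length L - 1" if "q \<in> Q" for q
  proof -
    have "q \<noteq> h" using that Q(3) by blast
    then have "e q \<noteq> e h" using nth_e(1) that by (metis insertCI)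
    then show ?thesis using nth_e(2)[of q] that eh by auto
  qed
  define M where "M = \<lparr>tm_tapes = k, tm_symbols = s, tm_states = length L - 1,
    tm_delta = (\<lambda>i rs. case \<delta> (L ! i) rs of (q', a) \<Rightarrow> (e q', a))\<rparr>"
  have nth_Q: "L ! i \<in> Q" if "i < length L - 1" for i
  proof -
    have "L ! i \<in> set L" using that by simp
    moreover have "L ! i \<noteq> h" using e_nth[of i] that eh by force
    ultimately show ?thesis using L(2) by blast
  qed
  have wf: "well_formed_tm M"
    unfolding well_formed_tm_def
  proof (intro conjI allI impI)
    show "tm_tapes M \<ge> 1" "tm_symbols M \<ge> 1" using k s by (simp_all add: M_def)
    fix i rs assume a: "i < tm_states M \<and> length rs = tm_tapes M \<and> set rs \<subseteq> {..<tm_symbols M}"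
    obtain q' as where d: "\<delta> (L ! i) rs = (q', as)" by (cases "\<delta> (L ! i) rs")
    have "L ! i \<in> Q" using nth_Q a by (simp add: M_def)
    from state[OF this, of rs] acts[OF this, of rs] a
    have "q' \<in> insert h Q" "length as = k" "fst ` set as \<subseteq> {..<s}" by (simp_all add: d M_def)
    then show "case tm_delta M i rs of (q', acts) \<Rightarrow>
        q' \<le> tm_states M \<and> length acts = tm_tapes M \<and> fst ` set acts \<subseteq> {..<tm_symbols M}"
      using nth_e(2)[of q'] by (auto simp: M_def d)
  qed
  have step: "tm_step M (e q, ts) = map_prod e id (control_step \<delta> h (q, ts))"
    if "q \<in> insert h Q" for q ts
  proof (cases "q = h")
    case True
    then show ?thesis by (simp add: tm_step_def control_step_def eh M_def)
  next
    case False
    then have "q \<in> Q" using that by simp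
    then show ?thesis using False lt nth_e(1)[OF that]
      by (simp add: tm_step_def control_step_def M_def split: prod.split)
  qed
  have closed: "fst (control_step \<delta> h (q, ts)) \<in> insert h Q" if "q \<in> insert h Q" for q ts
    using that state[of q "map (\<lambda>t. t 0) ts"] by (auto simp: control_step_def split: prod.splits)
  have "(tm_step M ^^ n) (e q\<^sub>0, ts) = map_prod e id ((control_step \<delta> h ^^ n) (q\<^sub>0, ts)) \<and>
      fst ((control_step \<delta> h ^^ n) (q\<^sub>0, ts)) \<in> insert h Q" for n ts
  proof (induction n)
    case 0
    then show ?case using Q(2) by simp
  next
    case (Suc n)
    obtain q ts' where q: "(control_step \<delta> h ^^ n) (q\<^sub>0, ts) = (q, ts')"
      by (cases "(control_step \<delta> h ^^ n) (q\<^sub>0, ts)")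
    with Suc have "q \<in> insert h Q" by simp
    from step[OF this] closed[OF this] show ?case using Suc q by (simp add: id_def)
  qed
  then have "(tm_step M ^^ n) (0, ts) = (tm_states M, ts')"
    if "(control_step \<delta> h ^^ n) (q\<^sub>0, ts) = (h, ts')" for n ts ts'
    using that by (simp add: e0 eh M_def)
  moreover have "tm_tapes M = k" "tm_symbols M = s" by (simp_all add: M_def)
  ultimately show ?thesis using wf that by blast
qed

section \<open>Tapes holding a word\<close>

text \<open>
  The tape that holds \<open>w\<close>, with the head at position \<open>i\<close>. A blank on either side of the word turns the
  cells next to its ends into positions as well, without changing the tape (\<open>tape_at_padded\<close>).
\<close>

definition tape_at :: "nat list \<Rightarrow> nat \<Rightarrow> tape" where
  "tape_at w i = (\<lambda>j. word_tape w (j + int i))"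

definition padded :: "nat list \<Rightarrow> nat list" where
  "padded w = 0 # w @ [0]"

lemma tape_at_0: "tape_at w 0 = word_tape w"
  by (simp add: tape_at_def)

lemma read_tape_at: "tape_at w i 0 = (if i < length w then w ! i else 0)"
  by (simp add: tape_at_def word_tape_def)

lemma tape_at_padded: "tape_at (padded w) (Suc i) = tape_at w i"
  by (auto simp: fun_eq_iff tape_at_def padded_def word_tape_def nth_append nth_Cons'
      nat_diff_distrib' nat_add_distrib split: if_splits intro!: arg_cong[where f = "(!) w"])

lemma act_keep: "act (t 0, d) t = move_head d t"
  by (simp only: act_def prod.case fun_upd_triv)

lemma keep_Stay [simp]: "act (t 0, Stay) t = t"
  by (simp add: act_keep)

lemma keep_Right [simp]: "act (tape_at w i 0, Move_Right) (tape_at w i) = tape_at w (Suc i)"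
  unfolding act_keep by (simp add: tape_at_def add.assoc)

lemma keep_Left [simp]: "act (tape_at w (Suc i) 0, Move_Left) (tape_at w (Suc i)) = tape_at w i"
  unfolding act_keep by (simp add: tape_at_def)

lemma append_Right: "act (a, Move_Right) (tape_at w (length w)) =
    tape_at (w @ [a]) (Suc (length w))"
  by (auto simp: act_def tape_at_def word_tape_def fun_eq_iff nth_append add.assoc)

lemma erase_Right: "act (0, Move_Right) (word_tape (a # w)) = word_tape w"
  by (auto simp: act_def word_tape_def fun_eq_iff nth_Cons' nat_diff_distrib'
      nat_add_distrib split: if_splits)

section \<open>The machine that writes the instance\<close>

text \<open>
  A scan moves the head on the second tape in direction \<open>dir\<close> until it reads \<open>stop\<close>. At every other
  symbol \<open>r\<close> it writes \<open>emit s r\<close> to the output; at \<open>stop\<close> it writes \<open>exit_emit\<close>, makes one move in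
  direction \<open>exit_dir\<close> and is finished.
\<close>

datatype scan =
  Scan (dir: move) (stop: nat) (emit: "nat \<Rightarrow> nat list") (exit_dir: move) (exit_emit: "nat list")

datatype phase = Copy | Next_Round | Next_Edge | Finish | Rewind | Halt

text \<open>
  The symbols that remain to be written, the scans that remain to be made after that, and the phase to
  be entered in the end.
\<close>

type_synonym control = "nat list \<times> scan list \<times> phase"

definition skip_block :: scan where
  "skip_block = Scan Move_Right 1 (\<lambda>_. []) Move_Right []"

definition to_start :: scan where
  "to_start = Scan Move_Left 0 (\<lambda>_. []) Move_Right []"

text \<open>
  The words \<open>fw\<close> and \<open>gw\<close> are constants of the machine. There are \<open>N\<close> letters in the input words and
  \<open>m\<close> letters in the output words, and \<open>D\<close> bounds the cost of a step of a scan together with the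
  writing that it causes.
\<close>

locale link_transducer =
  fixes fw :: "bool \<times> bool \<Rightarrow> gword" and gw :: "nat \<Rightarrow> gword" and N m D :: nat
  assumes fw: "\<And>c. fw c \<in> lists {..<m}" "\<And>c. length (fw c) < D"
    and gw: "\<And>i. i < N \<Longrightarrow> gw i \<in> lists {..<m}" "\<And>i. i < N \<Longrightarrow> length (gw i) < D"
    and D: "1 < D"
begin

text \<open>
  The default value keeps the range finite; a machine has finitely many states, and the words to be
  written are part of the state.
\<close>

definition letter_emit :: "nat \<Rightarrow> nat list" where
  "letter_emit r = (if 3 \<le> r \<and> r < N + 3 then enc_word (gw (r - 3)) else [])"

text \<open>
  Started on the first digit of a unary name \<open>n\<close> that lies between two separators, these scans write the
  word for \<open>z\<^sub>n\<close> or its inverse: forth with \<open>x\<close>, at the end \<open>y\<close> or \<open>y\<^sup>-\<^sup>1\<close>, back with \<open>x\<^sup>-\<^sup>1\<close>, and forth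
  once more to leave the name behind.
\<close>

definition vertex_prog :: "bool \<Rightarrow> nat list \<Rightarrow> scan list" where
  "vertex_prog b end =
     [Scan Move_Right 1 (\<lambda>_. enc_word (fw (True, True))) Move_Left (enc_word (fw (False, b))),
      Scan Move_Left 1 (\<lambda>_. enc_word (fw (True, False))) Move_Right [],
      Scan Move_Right 1 (\<lambda>_. []) Move_Right end]"

definition edge_prog :: "scan list" where
  "edge_prog = vertex_prog True [] @ [Scan Move_Right 1 letter_emit Move_Right []] @
     vertex_prog False [1]"

text \<open>
  The source and the target are stored before the word, but \<open>z\<^sub>\<omega>\<^sup>-\<^sup>1\<close> has to be written last, so the head
  returns to the start. The scan over the word leaves it to the left: behind the separator it might
  already stand on the blank at which the return stops.
\<close>

definition target_prog :: "scan list" where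
  "target_prog = [skip_block] @ vertex_prog True [] @
     [skip_block, Scan Move_Right 1 letter_emit Move_Left [], to_start, skip_block, skip_block] @
     vertex_prog False [1]"

definition header_prog :: "scan list" where
  "header_prog = replicate 4 skip_block"

text \<open>
  The head on the third tape starts on the last symbol of the input and moves left at the beginning of
  every round, until \<open>Next_Round\<close> finds the blank before the input.
\<close>

fun control_delta :: "control \<Rightarrow> nat list \<Rightarrow> control \<times> (nat \<times> move) list" where
  "control_delta (a # as, ss, c) rs =
      ((as, ss, c), [(a, Move_Right), (rs ! 1, Stay), (rs ! 2, Stay)])"
| "control_delta ([], s # ss, c) rs =
     (if rs ! 1 = stop s
      then ((exit_emit s, ss, c), [(rs ! 0, Stay), (rs ! 1, exit_dir s), (rs ! 2, Stay)])
      else ((emit s (rs ! 1), s # ss, c), [(rs ! 0, Stay), (rs ! 1, dir s), (rs ! 2, Stay)]))"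
| "control_delta ([], [], Copy) rs =
     (if rs ! 0 = 0
      then (([], [to_start], Next_Round), [(rs ! 0, Stay), (rs ! 1, Move_Left), (rs ! 2,
          Move_Left)])
      else (([], [], Copy), [(0, Move_Right), (rs ! 0, Move_Right), (rs ! 0, Move_Right)]))"
| "control_delta ([], [], Next_Round) rs =
     (if rs ! 2 = 0
      then (([], target_prog, Finish), [(rs ! 0, Stay), (rs ! 1, Stay), (rs ! 2, Stay)])
      else (([], header_prog, Next_Edge), [(rs ! 0, Stay), (rs ! 1, Stay), (rs ! 2, Move_Left)]))"
| "control_delta ([], [], Next_Edge) rs =
     (if rs ! 1 = 0
      then (([], [to_start], Next_Round), [(rs ! 0, Stay), (rs ! 1, Move_Left), (rs ! 2, Stay)])
      else (([], edge_prog, Next_Edge), [(rs ! 0, Stay), (rs ! 1, Stay), (rs ! 2, Stay)]))"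
| "control_delta ([], [], Finish) rs =
     (([], [], Rewind), [(rs ! 0, Move_Left), (rs ! 1, Stay), (rs ! 2, Stay)])"
| "control_delta ([], [], Rewind) rs =
     (if rs ! 0 = 0
      then (([], [], Halt), [(rs ! 0, Move_Right), (rs ! 1, Stay), (rs ! 2, Stay)])
      else (([], [], Rewind), [(rs ! 0, Move_Left), (rs ! 1, Stay), (rs ! 2, Stay)]))"
| "control_delta ([], [], Halt) rs =
     (([], [], Halt), [(rs ! 0, Stay), (rs ! 1, Stay), (rs ! 2, Stay)])"

abbreviation halted :: control where
  "halted \<equiv> ([], [], Halt)"

abbreviation step :: "control \<times> tape list \<Rightarrow> control \<times> tape list" where
  "step \<equiv> control_step control_delta halted"

definition progs :: "scan list set" where
  "progs = {[to_start], header_prog, edge_prog, target_prog}"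

text \<open>
  The words that a scan can leave to be written; a state contains a suffix of one of them.
\<close>

definition emissions :: "nat list set" where
  "emissions = insert [] (\<Union>ss\<in>progs. \<Union>s\<in>set ss. insert (exit_emit s) (range (emit s)))"

definition controls :: "control set" where
  "controls = {(as, ss, c). (\<exists>e\<in>emissions. suffix as e) \<and> (\<exists>p\<in>progs. suffix ss p)}"

lemma finite_phase: "finite (UNIV :: phase set)"
proof -
  have "c \<in> {Copy, Next_Round, Next_Edge, Finish, Rewind, Halt}" for c by (cases c) simp_all
  then have "(UNIV :: phase set) \<subseteq> {Copy, Next_Round, Next_Edge, Finish, Rewind, Halt}" by blast
  then show ?thesis by (rule finite_subset) simp
qed

lemma enc_word_fw: "set (enc_word (fw c)) \<subseteq> {1..<m + 3}" "length (enc_word (fw c)) < D"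
  using fw[of c] by (auto simp: enc_word_def)

lemma letter_emit: "set (letter_emit r) \<subseteq> {1..<m + 3}" "length (letter_emit r) < D"
proof -
  have *: "set (enc_word (gw i)) \<subseteq> {1..<m + 3} \<and> length (enc_word (gw i)) < D" if "i < N" for i
    using gw[OF that] by (force simp: enc_word_def)
  have "r - 3 < N" if "3 \<le> r" "r < N + 3" using that by simp
  with * show "set (letter_emit r) \<subseteq> {1..<m + 3}" "length (letter_emit r) < D"
    using D by (auto simp: letter_emit_def)
qed

lemma finite_range_letter_emit: "finite (range letter_emit)"
proof -
  have "range letter_emit \<subseteq> insert [] ((\<lambda>r. enc_word (gw (r - 3))) ` {..<N + 3})"
    by (auto simp: letter_emit_def)
  then show ?thesis by (rule finite_subset) simp
qed

lemmas prog_defs = header_prog_def edge_prog_def target_prog_def vertex_prog_def skip_block_def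
  to_start_def

lemma emissionsE:
  assumes "e \<in> emissions"
  shows "set e \<subseteq> {1..<m + 3}" "length e < D"
proof -
  have "e = [] \<or> (\<exists>c. e = enc_word (fw c)) \<or> (\<exists>r. e = letter_emit r) \<or> e = [1]"
    using assms by (auto simp: emissions_def progs_def prog_defs)
  then show "set e \<subseteq> {1..<m + 3}" "length e < D"
    by (elim disjE exE; use enc_word_fw letter_emit D in simp)+
qed

lemma finite_emissions: "finite emissions"
proof -
  have "finite (range (emit s))" if "s \<in> set ss" "ss \<in> progs" for s ss
    using that finite_range_letter_emit by (auto simp: progs_def prog_defs)
  then show ?thesis unfolding emissions_def
    by (intro finite.insertI finite_UN_I) (auto simp: progs_def)
qed

lemma finite_controls: "finite controls"
proof -
  have "controls \<subseteq> (\<Union>e\<in>emissions. set (suffixes e)) \<times> (\<Union>p\<in>progs. set (suffixes p)) \<times> UNIV"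
    by (auto simp: controls_def)
  moreover have "finite progs" by (simp add: progs_def)
  ultimately show ?thesis
    using finite_emissions finite_phase
    by (elim finite_subset) (intro finite_cartesian_product finite_UN_I finite_set)
qed

lemma control_delta_state:
  assumes "q \<in> controls"
  shows "fst (control_delta q rs) \<in> controls"
proof -
  obtain as ss c where q: "q = (as, ss, c)" by (rule prod_cases3)
  have ctl: "(as, ss, c) \<in> controls \<longleftrightarrow> (\<exists>e\<in>emissions. suffix as e) \<and> (\<exists>p\<in>progs. suffix ss p)"
    for as ss c by (simp add: controls_def)
  have e: "\<exists>e\<in>emissions. suffix as e" and p: "\<exists>p\<in>progs. suffix ss p"
    using assms by (simp_all add: q ctl)
  have nil: "\<exists>e\<in>emissions. suffix [] e" "\<exists>p\<in>progs. suffix [] p"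
    by (auto simp: emissions_def progs_def)
  have full: "\<exists>p\<in>progs. suffix [to_start] p" "\<exists>p\<in>progs. suffix header_prog p"
    "\<exists>p\<in>progs. suffix edge_prog p" "\<exists>p\<in>progs. suffix target_prog p"
    unfolding progs_def using suffix_order.order_refl by (metis insertCI)+
  show ?thesis
  proof (cases as)
    case (Cons a bs)
    then have "\<exists>e\<in>emissions. suffix bs e" using e by (meson suffix_ConsD)
    then show ?thesis using p by (simp add: q Cons ctl)
  next
    case as: Nil
    show ?thesis
    proof (cases ss)
      case (Cons s ss')
      obtain p where p': "p \<in> progs" "suffix ss p" using p by blast
      then have "s \<in> set p" using Cons by (metis list.set_intros(1) set_mono_suffix subsetD)
      then have "exit_emit s \<in> emissions" "emit s r \<in> emissions" for r
        using p'(1) unfolding emissions_def by blast+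
      then have "\<exists>e\<in>emissions. suffix (exit_emit s) e" "\<exists>e\<in>emissions. suffix (emit s r) e" for r
        using suffix_order.order_refl by metis+
      moreover have "\<exists>p\<in>progs. suffix ss' p" using p Cons by (meson suffix_ConsD)
      ultimately show ?thesis using p by (simp add: q as Cons ctl)
    next
      case Nil
      show ?thesis unfolding q as Nil
        by (cases c) (simp_all add: ctl nil[simplified] full)
    qed
  qed
qed

lemma control_delta_acts:
  assumes "q \<in> controls" "length rs = 3" "set rs \<subseteq> {..<N + m + 3}"
  shows "length (snd (control_delta q rs)) = 3 \<and>
    fst ` set (snd (control_delta q rs)) \<subseteq> {..<N + m + 3}"
proof -
  obtain as ss c where q: "q = (as, ss, c)" by (rule prod_cases3)
  have e: "\<exists>e\<in>emissions. suffix as e"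
    using assms(1) by (simp add: q controls_def)
  then have as: "set as \<subseteq> {..<N + m + 3}"
    using emissionsE(1) by (fastforce dest: set_mono_suffix)
  have r: "rs ! 0 < N + m + 3" "rs ! 1 < N + m + 3" "rs ! 2 < N + m + 3"
    using assms(2,3) nth_mem[of 0 rs] nth_mem[of 1 rs] nth_mem[of 2 rs]
    by (auto simp del: nth_mem)
  show ?thesis
    using as r unfolding q
    by (cases "((as, ss, c), rs)" rule: control_delta.cases) (auto simp del: One_nat_def)
qed

end

definition moved :: "move \<Rightarrow> nat \<Rightarrow> nat \<Rightarrow> bool" where
  "moved d i i' \<longleftrightarrow> (case d of Move_Left \<Rightarrow> i = Suc i' | Stay \<Rightarrow> i' = i | Move_Right \<Rightarrow> i' = Suc i)"

lemma act_moved: "moved d i i' \<Longrightarrow> act (tape_at w i 0, d) (tape_at w i) = tape_at w i'"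
  by (cases d) (auto simp: moved_def)

lemma moved_simps [simp]:
  "moved Move_Left i i' \<longleftrightarrow> i = Suc i'" "moved Stay i i' \<longleftrightarrow> i' = i" "moved Move_Right i i' \<longleftrightarrow> i' =
      Suc i"
  by (simp_all add: moved_def)

lemma enc_word_simps [simp]:
  "enc_word [] = []" "enc_word (u @ v) = enc_word u @ enc_word v"
  "enc_word (concat us) = concat (map enc_word us)" "length (enc_word u) = length u"
  by (simp_all add: enc_word_def[abs_def] map_concat)

context link_transducer
begin

definition config :: "nat list \<Rightarrow> nat list \<Rightarrow> control \<times> nat \<times> nat \<Rightarrow> control \<times> tape list" where
  "config w v = (\<lambda>(q, i, j). (q, [tape_at v (length v), tape_at w i, tape_at w j]))"

text \<open>
  Reads: from \<open>c\<close> the machine reaches \<open>c'\<close> in at most \<open>n\<close> steps and meanwhile appends \<open>out\<close> to the first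
  tape. The bound on the length of \<open>out\<close> is carried along because rewinding the first tape takes as many
  steps as there are symbols on it.
\<close>

definition run ::
  "nat list \<Rightarrow> control \<times> nat \<times> nat \<Rightarrow> nat \<Rightarrow> nat list \<Rightarrow> control \<times> nat \<times> nat \<Rightarrow> bool" where
  "run w c n out c' \<longleftrightarrow> length out \<le> n \<and>
     (\<forall>v. \<exists>k\<le>n. (step ^^ k) (config w v c) = config w (v @ out) c')"

lemma run_refl: "run w c 0 [] c"
  by (simp add: run_def)

lemma run_trans:
  assumes "run w c n x c'" "run w c' l y c''"
  shows "run w c (n + l) (x @ y) c''"
  unfolding run_def
proof (intro conjI allI)
  show "length (x @ y) \<le> n + l" using assms by (simp add: run_def)
  fix v
  obtain k where k: "k \<le> n" "(step ^^ k) (config w v c) = config w (v @ x) c'"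
    using assms(1) unfolding run_def by blast
  obtain k' where k': "k' \<le> l" "(step ^^ k') (config w (v @ x) c') = config w ((v @ x) @ y) c''"
    using assms(2) unfolding run_def by blast
  have "(step ^^ (k' + k)) (config w v c) = config w (v @ x @ y) c''"
    using k(2) k'(2) by (simp add: funpow_add)
  then show "\<exists>k\<le>n + l. (step ^^ k) (config w v c) = config w (v @ x @ y) c''"
    using k(1) k'(1) by (intro exI[of _ "k' + k"]) simp
qed

lemma run_mono: "run w c n x c' \<Longrightarrow> n \<le> l \<Longrightarrow> run w c l x c'"
  unfolding run_def by (meson order_trans)

lemma run_step: "(\<And>v. step (config w v c) = config w v c') \<Longrightarrow> run w c 1 [] c'"
  unfolding run_def by (auto intro!: exI[of _ 1])

lemma run_emit: "run w ((as, ss, c), i, j) (length as) as (([], ss, c), i, j)"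
proof (induction as)
  case Nil
  show ?case by (simp add: run_refl)
next
  case (Cons a as)
  have "step (config w v ((a # as, ss, c), i, j)) = config w (v @ [a]) ((as, ss, c), i, j)" for v
    by (simp add: config_def control_step_def append_Right)
  then have "run w ((a # as, ss, c), i, j) 1 [a] ((as, ss, c), i, j)"
    unfolding run_def by (auto intro!: exI[of _ 1])
  from run_trans[OF this Cons.IH] show ?case by simp
qed

lemma run_scan_step:
  assumes "i < length w" "w ! i \<noteq> stop s" "moved (dir s) i i'"
  shows "run w (([], s # ss, c), i, j) (1 + length (emit s (w ! i))) (emit s (w ! i)) (([],
      s # ss, c), i', j)"
proof -
  have "step (config w v (([], s # ss, c), i, j)) =
      config w v ((emit s (w ! i), s # ss, c), i', j)" for v
    using assms act_moved[OF assms(3), of w]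
    by (simp add: config_def control_step_def) (simp add: read_tape_at)
  from run_trans[OF run_step[OF this] run_emit] show ?thesis by simp
qed

lemma run_scan_exit:
  assumes "i < length w" "w ! i = stop s" "moved (exit_dir s) i i'"
  shows "run w (([], s # ss, c), i, j) (1 + length (exit_emit s)) (exit_emit s) (([], ss, c), i',
      j)"
proof -
  have "step (config w v (([], s # ss, c), i, j)) = config w v ((exit_emit s, ss, c), i', j)" for v
    using assms act_moved[OF assms(3), of w]
    by (simp add: config_def control_step_def) (simp add: read_tape_at)
  from run_trans[OF run_step[OF this] run_emit] show ?thesis by simp
qed

definition short :: "scan \<Rightarrow> bool" where
  "short s \<longleftrightarrow> (\<forall>r. length (emit s r) < D) \<and> length (exit_emit s) < D"

text \<open>
  Induction on the segment \<open>S\<close> that lies between the head and the first stop symbol; each of its symbols,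
  and the stop symbol, costs at most \<open>D\<close> steps.
\<close>

lemma run_scan_right_aux:
  assumes "short s" "dir s = Move_Right" "stop s \<notin> set S"
    and "moved (exit_dir s) (length A + length S) i'"
  shows "run (A @ S @ stop s # B) (([], s # ss, c), length A, j) (Suc (length S) * D)
    (concat (map (emit s) S) @ exit_emit s) (([], ss, c), i', j)"
  using assms(3,4)
proof (induction S arbitrary: A)
  case Nil
  have "1 + length (exit_emit s) \<le> D" using assms(1) by (simp add: short_def)
  with run_scan_exit[of "length A" "A @ stop s # B" s i' ss c j] Nil(2) show ?case
    by (auto elim: run_mono)
next
  case (Cons x S)
  have len: "1 + length (emit s x) \<le> D" using assms(1) by (simp add: short_def Suc_le_eq)
  have "run (A @ (x # S) @ stop s # B) (([], s # ss, c), length A, j) (1 + length (emit s x))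
      (emit s x)
      (([], s # ss, c), Suc (length A), j)"
    using run_scan_step[of "length A" "A @ (x # S) @ stop s # B" s "Suc (length A)" ss c j]
      Cons.prems(1) assms(2) by simp
  moreover have "run (A @ (x # S) @ stop s # B) (([], s # ss, c), Suc (length A), j)
      (Suc (length S) * D)
      (concat (map (emit s) S) @ exit_emit s) (([], ss, c), i', j)"
    using Cons.IH[of "A @ [x]"] Cons.prems by simp
  ultimately have "run (A @ (x # S) @ stop s # B) (([], s # ss, c), length A, j)
      ((1 + length (emit s x)) + Suc (length S) * D)
      (emit s x @ concat (map (emit s) S) @ exit_emit s) (([], ss, c), i', j)"
    by (rule run_trans)
  then have "run (A @ (x # S) @ stop s # B) (([], s # ss, c), length A, j) (Suc (length (x # S))
      * D)
      (emit s x @ concat (map (emit s) S) @ exit_emit s) (([], ss, c), i', j)"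
    by (rule run_mono) (use len in simp)
  then show ?case by simp
qed

lemma run_scan_left_aux:
  assumes "short s" "dir s = Move_Left" "stop s \<notin> set S" "moved (exit_dir s) (length A) i'"
  shows "run (A @ stop s # S @ B) (([], s # ss, c), length A + length S, j) (Suc (length S) * D)
    (concat (map (emit s) (rev S)) @ exit_emit s) (([], ss, c), i', j)"
  using assms(3)
proof (induction S arbitrary: B rule: rev_induct)
  case Nil
  have "1 + length (exit_emit s) \<le> D" using assms(1) by (simp add: short_def)
  with run_scan_exit[of "length A" "A @ stop s # B" s i' ss c j] assms(4) show ?case
    by (auto elim: run_mono)
next
  case (snoc x S)
  let ?w = "A @ stop s # (S @ [x]) @ B"
  have len: "1 + length (emit s x) \<le> D" using assms(1) by (simp add: short_def Suc_le_eq)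
  have nth: "?w ! Suc (length A + length S) = x" by (simp add: nth_append)
  have "run ?w (([], s # ss, c), Suc (length A + length S), j) (1 + length (emit s x)) (emit s x)
      (([], s # ss, c), length A + length S, j)"
    using run_scan_step[of "Suc (length A + length S)" ?w s "length A + length S" ss c j]
      snoc.prems assms(2) unfolding nth by simp
  moreover have "run ?w (([], s # ss, c), length A + length S, j) (Suc (length S) * D)
      (concat (map (emit s) (rev S)) @ exit_emit s) (([], ss, c), i', j)"
    using snoc.IH[of "x # B"] snoc.prems by simp
  ultimately have "run ?w (([], s # ss, c), Suc (length A + length S), j)
      ((1 + length (emit s x)) + Suc (length S) * D)
      (emit s x @ concat (map (emit s) (rev S)) @ exit_emit s) (([], ss, c), i', j)"
    by (rule run_trans)
  then have "run ?w (([], s # ss, c), Suc (length A + length S), j) (Suc (length (S @ [x])) * D)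
      (emit s x @ concat (map (emit s) (rev S)) @ exit_emit s) (([], ss, c), i', j)"
    by (rule run_mono) (use len in simp)
  then show ?case by simp
qed

text \<open>
  The estimate by the length of the whole tape is coarse, but it gives every scan the same bound.
\<close>

lemma run_scan_right:
  assumes "w = A @ S @ stop s # B" "short s" "dir s = Move_Right" "stop s \<notin> set S"
    and "moved (exit_dir s) (length A + length S) i'" "i = length A"
    and "x = concat (map (emit s) S) @ exit_emit s"
  shows "run w (([], s # ss, c), i, j) (length w * D) x (([], ss, c), i', j)"
  using run_scan_right_aux[OF assms(2-5), of B ss c j] unfolding assms(1,6,7)
  by (rule run_mono) simp

lemma run_scan_left:
  assumes "w = A @ stop s # S @ B" "short s" "dir s = Move_Left" "stop s \<notin> set S"
    and "moved (exit_dir s) (length A) i'" "i = length A + length S"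
    and "x = concat (map (emit s) (rev S)) @ exit_emit s"
  shows "run w (([], s # ss, c), i, j) (length w * D) x (([], ss, c), i', j)"
  using run_scan_left_aux[OF assms(2-5), of B ss c j] unfolding assms(1,6,7)
  by (rule run_mono) simp

lemma short_scans: "short skip_block" "short to_start" "short (Scan Move_Right 1 letter_emit d [])"
  using D letter_emit(2) by (auto simp: short_def skip_block_def to_start_def)

lemma run_skip:
  assumes "w = A @ S @ 1 # B" "1 \<notin> set S"
  shows "run w (([], skip_block # ss, c), length A, j) (length w * D) []
    (([], ss, c), Suc (length A + length S), j)"
  by (rule run_scan_right[of _ A S _ B]) (use assms short_scans in \<open>simp_all add: skip_block_def\<close>)

lemma run_to_start:
  assumes "w = padded u" "0 \<notin> set u" "i \<le> length u"
  shows "run w (([], to_start # ss, c), i, j) (length w * D) [] (([], ss, c), 1, j)"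
proof (rule run_scan_left[of _ "[]" _ "take i u" "drop i u @ [0]"])
  show "stop to_start \<notin> set (take i u)" using assms(2)
      by (auto simp: to_start_def dest: in_set_takeD)
qed (use assms short_scans in \<open>simp_all add: to_start_def padded_def\<close>)

lemma run_letters:
  assumes "w = A @ enc_word u @ 1 # B" "u \<in> lists {..<N}" "moved d (length A + length u) i'"
  shows "run w (([], Scan Move_Right 1 letter_emit d [] # ss, c), length A, j) (length w * D)
    (enc_word (concat (map gw u))) (([], ss, c), i', j)"
proof (rule run_scan_right[of _ A "enc_word u" _ B])
  have "map letter_emit (enc_word u) = map (\<lambda>i. enc_word (gw i)) u"
    using assms(2) by (auto simp: enc_word_def letter_emit_def)
  then show "enc_word (concat (map gw u)) =
      concat (map (emit (Scan Move_Right 1 letter_emit d [])) (enc_word u)) @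
      exit_emit (Scan Move_Right 1 letter_emit d [])"
    by (simp add: comp_def)
qed (use assms short_scans not_in_enc in simp_all)

lemma run_vertex:
  assumes w: "w = A @ 1 # enc_unary n @ 1 # B" and e: "length e < D"
  shows "run w (([], vertex_prog b e @ ss, c), Suc (length A), j) (3 * (length w * D))
    (enc_word (concat (map fw (vertex_letters n b))) @ e) (([], ss, c), length A + n + 2, j)"
proof -
  let ?s1 = "Scan Move_Right 1 (\<lambda>_. enc_word (fw (True, True))) Move_Left (enc_word (fw (False,
      b)))"
  let ?s2 = "Scan Move_Left 1 (\<lambda>_. enc_word (fw (True, False))) Move_Right []"
  let ?s3 = "Scan Move_Right 1 (\<lambda>_. []) Move_Right e"
  have s: "short ?s1" "short ?s2" "short ?s3"
    using e D enc_word_fw(2) unfolding short_def scan.sel by (auto simp del: enc_word_simps)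
  let ?x1 = "concat (map (\<lambda>_. enc_word (fw (True, True))) (enc_unary n)) @ enc_word (fw (False, b))"
  let ?x2 = "concat (map (\<lambda>_. enc_word (fw (True, False))) (rev (enc_unary n))) @ []"
  let ?x3 = "concat (map (\<lambda>_. []) (enc_unary n)) @ e"
  have u: "1 \<notin> set (enc_unary n)" "length (enc_unary n) = n" by (simp_all add: enc_unary_def)
  have 1: "run w (([], ?s1 # ss', c), Suc (length A), j) (length w * D) ?x1 (([], ss', c),
      length A + n, j)" for ss'
    by (rule run_scan_right[of _ "A @ [1]" "enc_unary n" _ B]) (use w s u in simp_all)
  have 2: "run w (([], ?s2 # ss', c), length A + n, j) (length w * D) ?x2 (([], ss', c),
      Suc (length A), j)" for ss'
    by (rule run_scan_left[of _ A _ "enc_unary n" "1 # B"]) (use w s u in simp_all)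
  have 3: "run w (([], ?s3 # ss, c), Suc (length A), j) (length w * D) ?x3 (([], ss, c),
      length A + n + 2, j)"
    by (rule run_scan_right[of _ "A @ [1]" "enc_unary n" _ B]) (use w s u in simp_all)
  have x: "?x1 @ ?x2 @ ?x3 = enc_word (concat (map fw (vertex_letters n b))) @ e"
    by (simp add: vertex_letters_def enc_unary_def map_replicate_const)
  have "run w (([], vertex_prog b e @ ss, c), Suc (length A), j)
      (length w * D + (length w * D + length w * D))
    (?x1 @ ?x2 @ ?x3) (([], ss, c), length A + n + 2, j)"
    using run_trans[OF 1 run_trans[OF 2 3]] unfolding vertex_prog_def append.simps .
  then show ?thesis unfolding x by (rule run_mono) simp
qed

lemma run_edge:
  assumes w: "w = A @ 1 # enc_edge e @ B" and l: "label_word (fst (snd e)) \<in> lists {..<N}"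
  shows "run w (([], edge_prog, c), Suc (length A), j) (7 * (length w * D))
    (enc_word (edge_word fw gw e) @ [1]) (([], [], c), Suc (length A + length (enc_edge e)), j)"
proof -
  obtain u l v where e: "e = (u, l, v)" by (rule prod_cases3)
  have len: "length (enc_unary n) = n" for n by (simp add: enc_unary_def)
  let ?lab = "enc_word (label_word l)"
  have 1: "run w (([], vertex_prog True [] @ ss, c), Suc (length A), j) (3 * (length w * D))
    (enc_word (concat (map fw (vertex_letters u True))) @ []) (([], ss, c), length A + u + 2,
        j)" for ss
    by (rule run_vertex) (use w D in \<open>simp_all add: e enc_edge_def\<close>)
  let ?A = "A @ 1 # enc_unary u @ [1]"
  have "run w (([], Scan Move_Right 1 letter_emit Move_Right [] # ss, c), length ?A, j)
      (length w * D)
    (enc_word (concat (map gw (label_word l)))) (([], ss, c), Suc (length ?A + length (label_word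
        l)), j)" for ss
    by (rule run_letters[of _ _ _ "enc_unary v @ 1 # B"]) (use w l in \<open>simp_all add: e
      enc_edge_def\<close>)
  then have 2: "run w (([], Scan Move_Right 1 letter_emit Move_Right [] # ss, c),
      length A + u + 2, j) (length w * D)
    (enc_word (concat (map gw (label_word l)))) (([], ss, c), length A + u + 3 + length
        (label_word l), j)" for ss
    by (simp add: len numeral_eq_Suc)
  let ?A = "A @ 1 # enc_unary u @ 1 # ?lab"
  have "run w (([], vertex_prog False [1] @ [], c), Suc (length ?A), j) (3 * (length w * D))
    (enc_word (concat (map fw (vertex_letters v False))) @ [1]) (([], [], c), length ?A + v + 2, j)"
    by (rule run_vertex) (use w D in \<open>simp_all add: e enc_edge_def\<close>)
  then have 3: "run w (([], vertex_prog False [1], c), length A + u + 3 + length (label_word l),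
      j) (3 * (length w * D))
    (enc_word (concat (map fw (vertex_letters v False))) @ [1])
    (([], [], c), Suc (length A + length (enc_edge e)), j)"
    by (simp add: len numeral_eq_Suc e enc_edge_def ac_simps)
  from run_trans[OF 1 run_trans[OF 2 3]] show ?thesis
    by (simp add: edge_prog_def e edge_word_def link_word_def algebra_simps)
qed

text \<open>
  The head is at the beginning of the encoding of \<open>es\<close>, right behind a separator. This is the separator
  that ends the header or the previous edge, and the one at which the first backward scan stops.
\<close>

lemma run_edges:
  assumes "w = padded u" "0 \<notin> set u" "w = A @ 1 # concat (map enc_edge es) @ [0]"
    and "\<forall>e\<in>set es. label_word (fst (snd e)) \<in> lists {..<N}"
  shows "run w (([], [], Next_Edge), Suc (length A), j)
    (length es * Suc (7 * (length w * D)) + Suc (length w * D))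
    (concat (map (\<lambda>e. enc_word (edge_word fw gw e) @ [1]) es)) (([], [], Next_Round), 1, j)"
  using assms(3,4)
proof (induction es arbitrary: A)
  case Nil
  have A: "length A = length u" using Nil(1) assms(1)
      by (auto simp: padded_def dest!: arg_cong[of _ _ length])
  have r: "tape_at w (Suc (length A)) 0 = 0"
    using Nil(1) by (simp add: read_tape_at nth_append)
  have "act (0, Move_Left) (tape_at w (Suc (length A))) = tape_at w (length A)"
    using keep_Left[of w "length A"] by (simp add: r)
  then have "step (config w v (([], [], Next_Edge), Suc (length A), j)) =
      config w v (([], [to_start], Next_Round), length A, j)" for v
    by (simp add: config_def control_step_def r)
  from run_trans[OF run_step[OF this] run_to_start[OF assms(1,2)]] A show ?case by simp
next
  case (Cons e es)
  obtain x y z where e: "e = (x, y, z)" by (rule prod_cases3)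
  obtain r where r: "w ! Suc (length A) = r" "r \<noteq> 0"
    using Cons.prems(1) by (cases x) (auto simp: e enc_edge_def enc_unary_def nth_append)
  have lt: "Suc (length A) < length w" using Cons.prems(1) by simp
  have "step (config w v (([], [], Next_Edge), Suc (length A), j)) =
      config w v (([], edge_prog, Next_Edge), Suc (length A), j)" for v
    using r lt by (simp add: config_def control_step_def) (simp add: read_tape_at)
  from run_step[OF this]
  have 1: "run w (([], [], Next_Edge), Suc (length A), j) 1 [] (([], edge_prog, Next_Edge),
      Suc (length A), j)" .
  have 2: "run w (([], edge_prog, Next_Edge), Suc (length A), j) (7 * (length w * D))
    (enc_word (edge_word fw gw e) @ [1]) (([], [], Next_Edge), Suc (length A + length (enc_edge
        e)), j)"
    by (rule run_edge[where B = "concat (map enc_edge es) @ [0]"]) (use Cons.prems in simp_all)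
  obtain F where F: "enc_edge e = F @ [1]" by (simp add: e enc_edge_def)
  have 3: "run w (([], [], Next_Edge), Suc (length A + length (enc_edge e)), j)
    (length es * Suc (7 * (length w * D)) + Suc (length w * D))
    (concat (map (\<lambda>e. enc_word (edge_word fw gw e) @ [1]) es)) (([], [], Next_Round), 1, j)"
    using Cons.IH[of "A @ 1 # F"] Cons.prems by (simp add: F)
  from run_trans[OF 1 run_trans[OF 2 3]] show ?case by (simp add: algebra_simps)
qed

end

lemma funpow_Suc_apply: "(f ^^ Suc n) x = (f ^^ n) (f x)"
  by (simp add: funpow_swap1)

context link_transducer
begin

section \<open>Phases of a run and their running time\<close>

text \<open>
  The part \<open>x\<close> of the input has been copied and the part \<open>y\<close> has not; the symbols of \<open>x\<close> are erased from
  the first tape, on which therefore only \<open>y\<close> is left.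
\<close>

lemma copy_input:
  assumes "0 \<notin> set y"
  shows "(step ^^ Suc (length y)) (([], [], Copy), [word_tape y, tape_at x (length x),
      tape_at x (length x)]) =
    (([], [to_start], Next_Round), [word_tape [], tape_at (padded (x @ y)) (length (x @ y)),
      tape_at (padded (x @ y)) (length (x @ y))])"
  using assms
proof (induction y arbitrary: x)
  case Nil
  have w0: "word_tape [] 0 = 0" by (simp add: word_tape_def)
  have left: "act (tape_at x (length x) 0, Move_Left) (tape_at x (length x)) =
      tape_at (padded x) (length x)"
    using keep_Left[of "padded x" "length x"] unfolding tape_at_padded .
  have stay: "act (0, Stay) (word_tape []) = word_tape []"
    using keep_Stay[of "word_tape []"] by (simp add: w0)
  show ?case using left stay by (simp add: control_step_def w0)
next
  case (Cons a y)
  have a: "word_tape (a # y) 0 = a" "a \<noteq> 0" using Cons.prems by (simp_all add: word_tape_def)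
  have "step (([], [], Copy), [word_tape (a # y), tape_at x (length x), tape_at x (length x)]) =
      (([], [], Copy), [word_tape y, tape_at (x @ [a]) (length (x @ [a])), tape_at (x @ [a])
          (length (x @ [a]))])"
    using a by (simp add: control_step_def erase_Right append_Right)
  note first = this
  have "(step ^^ Suc (length y)) (([], [], Copy),
      [word_tape y, tape_at (x @ [a]) (length (x @ [a])), tape_at (x @ [a]) (length (x @ [a]))]) =
    (([], [to_start], Next_Round), [word_tape [], tape_at (padded (x @ a # y)) (length (x @ a # y)),
      tape_at (padded (x @ a # y)) (length (x @ a # y))])"
    using Cons.IH[of "x @ [a]"] Cons.prems unfolding append_assoc append.simps by simp
  then show ?case unfolding length_Cons funpow_Suc_apply[of "Suc (length y)"] first .
qed

text \<open>
  The two additional steps lead onto the last symbol of the output and, at the end, back from the blank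
  before the first one.
\<close>

lemma rewind_output:
  assumes "0 \<notin> set v"
  shows "(step ^^ (length v + 2)) (([], [], Finish), [tape_at v (length v), t, t']) =
    (halted, [word_tape v, t, t'])"
proof -
  have loop: "(step ^^ Suc i) (([], [], Rewind), [tape_at (padded v) i, t, t']) =
      (halted, [word_tape v, t, t'])"
    if "i \<le> length v" for i
    using that
  proof (induction i)
    case 0
    have r: "tape_at (padded v) 0 0 = 0" by (simp add: read_tape_at padded_def)
    have "act (0, Move_Right) (tape_at (padded v) 0) = word_tape v"
      using keep_Right[of "padded v" 0] unfolding r tape_at_padded unfolding tape_at_0 .
    then show ?case by (simp add: control_step_def r)
  next
    case (Suc i)
    have r: "tape_at (padded v) (Suc i) 0 = v ! i"
      using Suc.prems by (simp add: read_tape_at padded_def nth_append)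
    have nz: "v ! i \<noteq> 0" using Suc.prems assms by (metis Suc_le_eq nth_mem)
    have "act (v ! i, Move_Left) (tape_at (padded v) (Suc i)) = tape_at (padded v) i"
      using keep_Left[of "padded v" i] by (simp add: r)
    then have "step (([], [], Rewind), [tape_at (padded v) (Suc i), t, t']) =
        (([], [], Rewind), [tape_at (padded v) i, t, t'])"
      using nz by (simp add: control_step_def r)
    then show ?case
      unfolding funpow_Suc_apply[of "Suc i"] using Suc by (simp only: Suc_leD)
  qed
  have "act (tape_at v (length v) 0, Move_Left) (tape_at v (length v)) =
      tape_at (padded v) (length v)"
    using keep_Left[of "padded v" "length v"] unfolding tape_at_padded .
  then have "step (([], [], Finish), [tape_at v (length v), t, t']) =
      (([], [], Rewind), [tape_at (padded v) (length v), t, t'])"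
    by (simp add: control_step_def)
  then show ?thesis
    unfolding add_2_eq_Suc' funpow_Suc_apply[of "Suc (length v)"] using loop[OF order_refl]
        by (simp only:)
qed

lemma enc_agwp_split:
  "enc_agwp \<Gamma> = enc_unary (ag_order \<Gamma>) @ 1 # enc_unary (ag_source \<Gamma>) @ 1 #
     enc_unary (ag_target \<Gamma>) @ 1 # enc_word (ag_word \<Gamma>) @ 1 # concat (map enc_edge (ag_edges \<Gamma>))"
  by (simp add: enc_agwp_def)

lemma zero_notin_enc_agwp: "0 \<notin> set (enc_agwp \<Gamma>)"
  by (auto simp: enc_agwp_def enc_unary_def enc_word_def enc_edge_def)

definition edges_output :: "agwp_instance \<Rightarrow> nat list" where
  "edges_output \<Gamma> = concat (map (\<lambda>e. enc_word (edge_word fw gw e) @ [1]) (ag_edges \<Gamma>))"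

definition target_output :: "agwp_instance \<Rightarrow> nat list" where
  "target_output \<Gamma> = enc_word (link_word fw gw (ag_source \<Gamma>) (ag_word \<Gamma>) (ag_target \<Gamma>)) @ [1]"

text \<open>
  Bounds on the number of steps of a single scan, of a round, and of the whole part of a run that lies
  between copying and rewinding.
\<close>

definition scan_time :: "agwp_instance \<Rightarrow> nat" where
  "scan_time \<Gamma> = length (padded (enc_agwp \<Gamma>)) * D"

definition round_time :: "agwp_instance \<Rightarrow> nat" where
  "round_time \<Gamma> = 1 + (4 * scan_time \<Gamma> +
     (length (ag_edges \<Gamma>) * Suc (7 * scan_time \<Gamma>) + Suc (scan_time \<Gamma>)))"

definition run_time :: "agwp_instance \<Rightarrow> nat" where
  "run_time \<Gamma> = scan_time \<Gamma> +
     (length (enc_agwp \<Gamma>) * round_time \<Gamma> + (1 + 12 * scan_time \<Gamma>))"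

context
  fixes \<Gamma> :: agwp_instance
  assumes labels: "\<forall>e\<in>set (ag_edges \<Gamma>). label_word (fst (snd e)) \<in> lists {..<N}"
    and target_word: "ag_word \<Gamma> \<in> lists {..<N}"
begin

abbreviation "inp \<equiv> enc_agwp \<Gamma>"
abbreviation "pin \<equiv> padded inp"
abbreviation "header_length \<equiv> ag_order \<Gamma> + ag_source \<Gamma> + ag_target \<Gamma> + length (ag_word \<Gamma>) + 4"

lemmas input_layout = padded_def enc_agwp_split scan_time_def

lemma length_enc_unary: "length (enc_unary n) = n"
  by (simp add: enc_unary_def)

lemma skip_order:
  "run pin (([], skip_block # ss, c), 1, j) (scan_time \<Gamma>) [] (([], ss, c), ag_order \<Gamma> + 2, j)"
  using run_skip[of pin "[0]" "enc_unary (ag_order \<Gamma>)" _ ss c j] not_in_enc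
  by (simp add: input_layout length_enc_unary)

lemma skip_source:
  "run pin (([], skip_block # ss, c), ag_order \<Gamma> + 2, j) (scan_time \<Gamma>) []
    (([], ss, c), ag_order \<Gamma> + ag_source \<Gamma> + 3, j)"
  using run_skip[of pin "0 # enc_unary (ag_order \<Gamma>) @ [1]" "enc_unary (ag_source \<Gamma>)" _ ss c j]
      not_in_enc
  by (simp add: input_layout length_enc_unary numeral_eq_Suc)

lemma skip_target:
  "run pin (([], skip_block # ss, c), ag_order \<Gamma> + ag_source \<Gamma> + 3, j) (scan_time \<Gamma>) []
    (([], ss, c), ag_order \<Gamma> + ag_source \<Gamma> + ag_target \<Gamma> + 4, j)"
  using run_skip[of pin "0 # enc_unary (ag_order \<Gamma>) @ 1 # enc_unary (ag_source \<Gamma>) @ [1]"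
    "enc_unary (ag_target \<Gamma>)" _ ss c j] not_in_enc
  by (simp add: input_layout length_enc_unary numeral_eq_Suc ac_simps)

lemma skip_word:
  "run pin (([], skip_block # ss, c), ag_order \<Gamma> + ag_source \<Gamma> + ag_target \<Gamma> + 4, j) (scan_time \<Gamma>)
      []
    (([], ss, c), Suc header_length, j)"
  using run_skip[of pin "0 # enc_unary (ag_order \<Gamma>) @ 1 # enc_unary (ag_source \<Gamma>) @ 1 #
    enc_unary (ag_target \<Gamma>) @ [1]" "enc_word (ag_word \<Gamma>)" _ ss c j] not_in_enc
  by (simp add: input_layout length_enc_unary numeral_eq_Suc ac_simps)

lemma run_round:
  assumes "j < length inp"
  shows "run pin (([], [], Next_Round), 1, Suc j) (round_time \<Gamma>) (edges_output \<Gamma>) (([], [],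
      Next_Round), 1, j)"
proof -
  have r: "tape_at pin (Suc j) 0 = inp ! j"
    using assms by (simp add: read_tape_at padded_def nth_append)
  have nz: "inp ! j \<noteq> 0" using assms zero_notin_enc_agwp by (metis nth_mem)
  have "act (inp ! j, Move_Left) (tape_at pin (Suc j)) = tape_at pin j"
    using keep_Left[of pin j] by (simp add: r)
  then have "step (config pin v (([], [], Next_Round), 1, Suc j)) =
      config pin v (([], header_prog, Next_Edge), 1, j)" for v
    using nz by (simp add: config_def control_step_def r)
  from run_step[OF this]
  have 1: "run pin (([], [], Next_Round), 1, Suc j) 1 [] (([], header_prog, Next_Edge), 1, j)" .
  have 2: "run pin (([], header_prog, Next_Edge), 1, j) (4 * (scan_time \<Gamma>)) [] (([], [],
      Next_Edge), Suc header_length, j)"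
    using run_trans[OF skip_order run_trans[OF skip_source run_trans[OF skip_target skip_word]]]
    by (simp add: header_prog_def numeral_eq_Suc)
  let ?A = "0 # enc_unary (ag_order \<Gamma>) @ 1 # enc_unary (ag_source \<Gamma>) @ 1 #
    enc_unary (ag_target \<Gamma>) @ 1 # enc_word (ag_word \<Gamma>)"
  have len: "header_length = length ?A" by (simp add: length_enc_unary)
  have 3: "run pin (([], [], Next_Edge), Suc header_length, j)
      (length (ag_edges \<Gamma>) * Suc (7 * (scan_time \<Gamma>)) + Suc (scan_time \<Gamma>)) (edges_output \<Gamma>) (([],
          [], Next_Round), 1, j)"
    unfolding edges_output_def len scan_time_def
    by (rule run_edges[OF HOL.refl zero_notin_enc_agwp _ labels]) (simp add: input_layout)
  from run_trans[OF 1 run_trans[OF 2 3]] show ?thesis by (simp add: round_time_def)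
qed

lemma run_rounds:
  "j \<le> length inp \<Longrightarrow> run pin (([], [], Next_Round), 1, j) (j * (round_time \<Gamma>))
    (concat (replicate j (edges_output \<Gamma>))) (([], [], Next_Round), 1, 0)"
proof (induction j)
  case 0
  show ?case by (simp add: run_refl)
next
  case (Suc j)
  have "j < length inp" using Suc.prems by simp
  from run_trans[OF run_round[OF this] Suc.IH] this show ?case by simp
qed

lemma run_target:
  "run pin (([], [], Next_Round), 1, 0) (1 + 12 * (scan_time \<Gamma>)) (target_output \<Gamma>)
    (([], [], Finish), ag_order \<Gamma> + ag_source \<Gamma> + ag_target \<Gamma> + 4, 0)"
proof -
  have r: "tape_at pin 0 0 = 0" by (simp add: read_tape_at padded_def)
  have stay: "act (0, Stay) (tape_at pin 0) = tape_at pin 0"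
    using keep_Stay[of "tape_at pin 0"] by (simp add: r)
  have "step (config pin v (([], [], Next_Round), 1, 0)) =
      config pin v (([], target_prog, Finish), 1, 0)" for v
    using stay by (simp add: config_def control_step_def r)
  from run_step[OF this]
  have 1: "run pin (([], [], Next_Round), 1, 0) 1 [] (([], target_prog, Finish), 1, 0)" .
  have 2: "run pin (([], vertex_prog True [] @ ss, Finish), ag_order \<Gamma> + 2, 0) (3 * (scan_time \<Gamma>))
      (enc_word (concat (map fw (vertex_letters (ag_source \<Gamma>) True))) @ [])
      (([], ss, Finish), ag_order \<Gamma> + ag_source \<Gamma> + 3, 0)" for ss
    using run_vertex[of pin "0 # enc_unary (ag_order \<Gamma>)" "ag_source \<Gamma>" _ "[]" True ss Finish 0] D
    by (simp add: input_layout length_enc_unary numeral_eq_Suc)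
  have 3: "run pin (([], Scan Move_Right 1 letter_emit Move_Left [] # ss, Finish),
      ag_order \<Gamma> + ag_source \<Gamma> + ag_target \<Gamma> + 4, 0)
      (scan_time \<Gamma>) (enc_word (concat (map gw (ag_word \<Gamma>))))
      (([], ss, Finish), ag_order \<Gamma> + ag_source \<Gamma> + ag_target \<Gamma> + 3 + length (ag_word \<Gamma>), 0)" for ss
    using run_letters[of pin "0 # enc_unary (ag_order \<Gamma>) @ 1 # enc_unary (ag_source \<Gamma>) @ 1 #
      enc_unary (ag_target \<Gamma>) @ [1]" "ag_word \<Gamma>" "concat (map enc_edge (ag_edges \<Gamma>)) @
          [0]" Move_Left _ ss Finish 0]
      target_word
    by (simp add: input_layout length_enc_unary numeral_eq_Suc ac_simps)
  have 4: "run pin (([], to_start # ss, Finish),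
      ag_order \<Gamma> + ag_source \<Gamma> + ag_target \<Gamma> + 3 + length (ag_word \<Gamma>), 0)
      (scan_time \<Gamma>) [] (([], ss, Finish), 1, 0)" for ss
    by (rule run_to_start[OF HOL.refl zero_notin_enc_agwp, folded scan_time_def]) (simp add:
      enc_agwp_split length_enc_unary)
  have 5: "run pin (([], vertex_prog False [1] @ [], Finish), ag_order \<Gamma> + ag_source \<Gamma> + 3, 0)
      (3 * (scan_time \<Gamma>))
      (enc_word (concat (map fw (vertex_letters (ag_target \<Gamma>) False))) @ [1])
      (([], [], Finish), ag_order \<Gamma> + ag_source \<Gamma> + ag_target \<Gamma> + 4, 0)"
    using run_vertex[of pin "0 # enc_unary (ag_order \<Gamma>) @ 1 # enc_unary (ag_source \<Gamma>)"
        "ag_target \<Gamma>" _ "[1]" False "[]" Finish 0] D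
    by (simp add: input_layout length_enc_unary numeral_eq_Suc ac_simps)
  have "run pin (([], target_prog, Finish), 1, 0) (12 * (scan_time \<Gamma>)) (target_output \<Gamma>)
    (([], [], Finish), ag_order \<Gamma> + ag_source \<Gamma> + ag_target \<Gamma> + 4, 0)"
    using run_trans[OF skip_order run_trans[OF 2 run_trans[OF skip_target run_trans[OF 3
        run_trans[OF 4
      run_trans[OF skip_order run_trans[OF skip_source 5]]]]]]]
    by (simp add: target_prog_def target_output_def link_word_def mult.commute)
  from run_trans[OF 1 this] show ?thesis by simp
qed

lemma encoding_agwp_to_ssp:
  "encoding (SSP K ys) (agwp_to_ssp fw gw \<Gamma>) =
      concat (replicate (length inp) (edges_output \<Gamma>)) @ (target_output \<Gamma>)"
proof -
  have "concat (map (\<lambda>v. enc_word v @ [1]) (concat (replicate n (map (edge_word fw gw)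
      (ag_edges \<Gamma>))))) =
      concat (replicate n (edges_output \<Gamma>))" for n
    by (induction n) (simp_all add: edges_output_def comp_def)
  then show ?thesis by (simp add: SSP_def agwp_to_ssp_def target_output_def)
qed

lemma zero_notin_output: "0 \<notin> set (concat (replicate (length inp) (edges_output \<Gamma>))
    @ (target_output \<Gamma>))"
  by (auto simp: edges_output_def target_output_def enc_word_def)

lemma transduces:
  "\<exists>t\<le>length inp + 2 * (run_time \<Gamma>) + 3. \<exists>ts.
    (step ^^ t) (([], [], Copy), [word_tape inp, word_tape [], word_tape []]) =
      (halted, word_tape (encoding (SSP K ys) (agwp_to_ssp fw gw \<Gamma>)) # ts)"
proof -
  let ?out = "concat (replicate (length inp) (edges_output \<Gamma>)) @ (target_output \<Gamma>)"
  let ?p = "ag_order \<Gamma> + ag_source \<Gamma> + ag_target \<Gamma> + 4"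
  have 1: "(step ^^ Suc (length inp)) (([], [], Copy), [word_tape inp, word_tape [],
      word_tape []]) =
      config pin [] (([], [to_start], Next_Round), length inp, length inp)"
    using copy_input[OF zero_notin_enc_agwp, where x = "[]"] by (simp add: config_def tape_at_0)
  have "run pin (([], [to_start], Next_Round), length inp, length inp) (scan_time \<Gamma>) []
      (([], [], Next_Round), 1, length inp)"
    by (rule run_to_start[OF HOL.refl zero_notin_enc_agwp, folded scan_time_def]) simp
  from run_trans[OF this run_trans[OF run_rounds run_target]]
  have "run pin (([], [to_start], Next_Round), length inp, length inp) (run_time \<Gamma>) ?out (([], [],
      Finish), ?p, 0)"
    by (simp add: run_time_def)
  then have len: "length ?out \<le> (run_time \<Gamma>)" and
    "\<exists>k\<le>(run_time \<Gamma>). (step ^^ k) (config pin [] (([], [to_start], Next_Round), length inp,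
        length inp)) =
      config pin ([] @ ?out) (([], [], Finish), ?p, 0)"
    unfolding run_def by blast+
  then obtain k where k: "k \<le> (run_time \<Gamma>)"
    "(step ^^ k) (config pin [] (([], [to_start], Next_Round), length inp, length inp)) =
      config pin ?out (([], [], Finish), ?p, 0)"
    by auto
  define r where "r = length ?out + 2"
  have 3: "(step ^^ r) (config pin ?out (([], [], Finish), ?p, 0)) =
      (halted, [word_tape ?out, tape_at pin ?p, tape_at pin 0])"
    unfolding config_def prod.case r_def by (rule rewind_output[OF zero_notin_output])
  let ?t = "r + (k + Suc (length inp))"
  have "(step ^^ ?t) (([], [], Copy), [word_tape inp, word_tape [], word_tape []]) =
      (halted, [word_tape ?out, tape_at pin ?p, tape_at pin 0])"
    unfolding funpow_add comp_apply 1 k(2) 3 ..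
  moreover have "?t \<le> length inp + 2 * (run_time \<Gamma>) + 3" using k(1) len by (simp only: r_def)
  ultimately show ?thesis unfolding encoding_agwp_to_ssp by blast
qed

end

text \<open>
  The time for copying, twice \<open>run_time\<close>, for the rounds and for rewinding an output that is not longer
  than the time spent on writing it, and a constant.
\<close>

definition time_poly :: "nat poly" where
  "time_poly =
     (let l = [:0, 1:]; s = (l + 2) * [:D:]; r = 2 + 5 * s + l * (7 * s + 1)
      in l + 2 * (s + (l * r + (1 + 12 * s))) + 3)"

lemma run_time_le_poly:
  "length (enc_agwp \<Gamma>) + 2 * run_time \<Gamma> + 3 \<le> poly time_poly (length (enc_agwp \<Gamma>))"
proof -
  define L where "L = length (enc_agwp \<Gamma>)"
  define s where "s = (L + 2) * D"
  have s: "scan_time \<Gamma> = s" by (simp add: scan_time_def s_def L_def padded_def)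
  have "length (ag_edges \<Gamma>) * Suc (7 * s) \<le> L * (7 * s + 1)"
    unfolding L_def using length_edges_le_enc[of \<Gamma>] by (intro mult_le_mono) simp_all
  then have R: "round_time \<Gamma> \<le> 2 + 5 * s + L * (7 * s + 1)"
    unfolding round_time_def s by linarith
  have "L + 2 * run_time \<Gamma> + 3 \<le> L + 2 * (s + (L * (2 + 5 * s + L * (7 * s + 1)) + (1 + 12 * s)))
      + 3"
    unfolding run_time_def s L_def[symmetric] by (intro add_le_mono mult_le_mono order_refl R)
  also have "\<dots> = poly time_poly L"
    by (simp only: time_poly_def Let_def s_def poly_add poly_mult poly_pCons poly_0 poly_1
      poly_numeral
        mult_zero_right mult_1_right add_0_right add_0_left)
  finally show ?thesis by (simp only: L_def)
qed

lemma poly_time_agwp_to_ssp: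
  assumes "N = length xs" "m = length ys"
  shows "poly_time_computable (agwp_instances xs) enc_agwp (encoding (SSP K ys))
      (agwp_to_ssp fw gw)"
proof -
  have start: "([], [], Copy) \<in> controls - {halted}"
    by (auto simp: controls_def emissions_def progs_def)
  obtain M where M: "well_formed_tm M" "tm_tapes M = 3" "tm_symbols M = N + m + 3"
    "\<And>n ts ts'. (step ^^ n) (([], [], Copy), ts) = (halted, ts') \<Longrightarrow>
      (tm_step M ^^ n) (0, ts) = (tm_states M, ts')"
  proof (rule finite_control_tm[of "controls - {halted}" "([], [], Copy)" halted 3 "N + m + 3"
      control_delta])
    show "finite (controls - {halted})" using finite_controls by simp
    show "fst (control_delta q rs) \<in> insert halted (controls - {halted})"
      if "q \<in> controls - {halted}" for q rs
      using control_delta_state[of q rs] that by blast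
    show "length (snd (control_delta q rs)) = 3 \<and>
        fst ` set (snd (control_delta q rs)) \<subseteq> {..<N + m + 3}"
      if "q \<in> controls - {halted}" "length rs = 3" "set rs \<subseteq> {..<N + m + 3}" for q rs
      using control_delta_acts that by blast
  qed (use start in simp_all)
  have good: "set (enc_agwp \<Gamma>) \<subseteq> {1..<tm_symbols M} \<and>
      tm_computes_within M (enc_agwp \<Gamma>) (poly time_poly (length (enc_agwp \<Gamma>)))
        (encoding (SSP K ys) (agwp_to_ssp fw gw \<Gamma>))" if "\<Gamma> \<in> agwp_instances xs" for \<Gamma>
  proof -
    have lab: "\<forall>e\<in>set (ag_edges \<Gamma>). label_word (fst (snd e)) \<in> lists {..<N}"
      and word: "ag_word \<Gamma> \<in> lists {..<N}"
      using that assms(1) by (force simp: agwp_instances_def words_def)+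
    have ew: "set (enc_word u) \<subseteq> {1..<N + m + 3}" if "u \<in> lists {..<N}" for u
      using that by (fastforce simp: enc_word_def)
    have eu': "x = 2" if "x \<in> set (enc_unary n)" for x n using that by (simp add: enc_unary_def)
    have eu: "set (enc_unary n) \<subseteq> {1..<N + m + 3}" for n by (auto simp: enc_unary_def)
    have ee: "set (enc_edge e) \<subseteq> {1..<N + m + 3}" if "e \<in> set (ag_edges \<Gamma>)" for e
      using ew[of "label_word (fst (snd e))"] lab that
      unfolding enc_edge_def by (auto simp del: enc_word_simps dest: eu')
    have "set (concat (map enc_edge (ag_edges \<Gamma>))) \<subseteq> {1..<N + m + 3}"
      using ee by (simp add: UN_subset_iff)
    then have alphabet: "set (enc_agwp \<Gamma>) \<subseteq> {1..<tm_symbols M}"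
      using ew[OF word] eu unfolding enc_agwp_def M(3) by (simp add: Un_subset_iff)
    obtain t ts where t: "t \<le> length (enc_agwp \<Gamma>) + 2 * run_time \<Gamma> + 3"
      "(step ^^ t) (([], [], Copy), [word_tape (enc_agwp \<Gamma>), word_tape [], word_tape []]) =
        (halted, word_tape (encoding (SSP K ys) (agwp_to_ssp fw gw \<Gamma>)) # ts)"
      using transduces[OF lab word] by blast
    have "tm_init M (enc_agwp \<Gamma>) = (0, [word_tape (enc_agwp \<Gamma>), word_tape [], word_tape []])"
      by (simp add: tm_init_def M(2) numeral_eq_Suc)
    with M(4)[OF t(2)] have "(tm_step M ^^ t) (tm_init M (enc_agwp \<Gamma>)) =
        (tm_states M, word_tape (encoding (SSP K ys) (agwp_to_ssp fw gw \<Gamma>)) # ts)"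
      by (simp only:)
    moreover have "t \<le> poly time_poly (length (enc_agwp \<Gamma>))"
      by (rule order_trans[OF t(1) run_time_le_poly])
    ultimately have "tm_computes_within M (enc_agwp \<Gamma>) (poly time_poly (length (enc_agwp \<Gamma>)))
        (encoding (SSP K ys) (agwp_to_ssp fw gw \<Gamma>))"
      unfolding tm_computes_within_def by (intro exI conjI)
    then show ?thesis by (intro conjI alphabet)
  qed
  show ?thesis
    unfolding poly_time_computable_def
    by (intro exI[of _ M] exI[of _ time_poly] conjI[OF M(1)] ballI good)
qed

end

section \<open>The reduction\<close>

lemma (in free_rank_two_retract) AGWP_reducible_SSP: "AGWP G xs \<le>\<^sub>P SSP K ys"
proof -
  define W where "W = range fw \<union> gw ` {..<length xs}"
  have "finite W" by (simp add: W_def)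
  then have "finite (length ` W)" by simp
  then obtain D where D: "\<forall>n\<in>length ` W. n < D" using finite_nat_set_iff_bounded by blast
  interpret T: link_transducer fw gw "length xs" "length ys" "D + 2"
  proof
    show "fw c \<in> lists {..<length ys}" for c using fw(1) by (simp add: words_def)
    show "gw i \<in> lists {..<length ys}" if "i < length xs" for i
      using gw(1)[OF that] by (simp add: words_def)
    have W: "length u < D + 2" if "u \<in> W" for u
    proof -
      have "length u < D" using D that by simp
      then show ?thesis by simp
    qed
    show "length (fw c) < D + 2" for c by (rule W) (simp add: W_def)
    show "length (gw i) < D + 2" if "i < length xs" for i by (rule W) (simp add: W_def that)
  qed simp
  have "poly_time_computable (agwp_instances xs) enc_agwp (encoding (SSP K ys)) (agwp_to_ssp fw gw)"
    by (rule T.poly_time_agwp_to_ssp) simp_all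
  moreover have "instances (AGWP G xs) = agwp_instances xs" "encoding (AGWP G xs) = enc_agwp"
    by (simp_all add: AGWP_def)
  ultimately show ?thesis
    unfolding P_reducible_def using agwp_to_ssp_correct
    by (intro exI[of _ "agwp_to_ssp fw gw"]) simp
qed

theorem proposition5:
  fixes G :: "('a, 'm) monoid_scheme" and xs :: "'a list"
  assumes "monoid G" and "generating_family G xs"
  shows "(\<forall>ys. generating_family (free_product G F\<^sub>2) ys \<longrightarrow>
            AGWP G xs \<le>\<^sub>P SSP (free_product G F\<^sub>2) ys) \<and>
         (\<forall>zs. generating_family (G \<times>\<times> F\<^sub>2) zs \<longrightarrow>
            AGWP G xs \<le>\<^sub>P SSP (G \<times>\<times> F\<^sub>2) zs)"
proof (intro conjI allI impI)
  fix ys assume "generating_family (free_product G F\<^sub>2) ys"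
  then show "AGWP G xs \<le>\<^sub>P SSP (free_product G F\<^sub>2) ys"
    by (rule free_product_retract[OF assms]) (rule free_rank_two_retract.AGWP_reducible_SSP)
next
  fix zs assume "generating_family (G \<times>\<times> F\<^sub>2) zs"
  then show "AGWP G xs \<le>\<^sub>P SSP (G \<times>\<times> F\<^sub>2) zs"
    by (rule direct_product_retract[OF assms]) (rule free_rank_two_retract.AGWP_reducible_SSP)
qed

end
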